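(* Let $n\ge4$ and let $l$ be an integer with $2\le l\le\lfloor n/2\rfloor$. Put $$a_l=\Big(\frac{U_{e0}}{I_0}+I_0U_{l1}\Big)\Big(\frac{U_{e0}}{I_0}+I_0U'_{l2}\Big)-I_0^2\,U'_{l1}U_{l2}.$$ If $$a_l\Big(\frac{U_{e0}}{I_0}+I_0U'_{l2}\Big)<0,$$ then there exists a unique positive value of the central mass $m$ for which $\det A_l=0$, namely $$m_l^*=-\frac{a_l}{3I_0\left(\frac{U_{e0}}{I_0}+I_0U'_{l2}\right)}.$$
   Context: Let $\theta=2\pi/n$, $q_k=(\cos k\theta,\sin k\theta)$, $\tau_k=(-\sin k\theta,\cos k\theta)$ for $k=1,\dots,n$, $q_{n+1}=(0,0)$, and $z_0=(q_1,\dots,q_{n+1})\in(\mathbb R^2)^{n+1}=\mathbb R^{2n+2}$ (the central $+$ regular $n$-gon configuration). The masses are $m_1=\dots=m_n=1$, $m_{n+1}=m>0$. For collision-free $z=(x_1,\dots,x_{n+1})$ put $I=\frac12\sum_i m_i|x_i|^2$, $U=\sum_{i<j}\frac{m_im_j}{|x_i-x_j|}$, $f=\sqrt{2I}\,U$, and let $H=D^2f(z_0)$. Notation: $I_0=\sqrt{2I(z_0)}=\sqrt n$; $d_{kj}=|q_k-q_j|=2\sin\frac{|k-j|\theta}{2}$ for $1\le k,j\le n$; $U_{e0}=\sum_{1\le k<j\le n}\frac1{d_{kj}}$ (so $U(z_0)=U_{e0}+nm$); and, with $i=\sqrt{-1}$, $$U_{l1}=\sum_{k=1}^{n-1}\frac{1-\cos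 k\theta\cos lk\theta-3(\cos k\theta-\cos lk\theta)}{2d_{nk}^3},\qquad U_{l2}=\sum_{k=1}^{n-1}\frac{i\sin k\theta\sin lk\theta}{2d_{nk}^3},$$ $$U'_{l1}=\sum_{k=1}^{n-1}\frac{-i\sin k\theta\sin lk\theta}{2d_{nk}^3},\qquad U'_{l2}=\sum_{k=1}^{n-1}\frac{1-\cos k\theta\cos lk\theta+3(\cos k\theta-\cos lk\theta)}{2d_{nk}^3}.$$ Let $v_l,v_l',w_l\in(\mathbb R^2)^{n+1}$ have $(n+1)$-st component $0$ and $k$-th component ($1\le k\le n$) $\cos(lk\theta)q_k$, $-\sin(lk\theta)\tau_k$, $\cos(lk\theta)\tau_k$ respectively. For $2\le l<n/2$ the space $\operatorname{span}\{v_l,v_l'\}$ is $H$-invariant and $A_l$ is the $2\times2$ matrix of the restriction of $H$ to it in the basis $(v_l,v_l')$; for $n$ even and $l=n/2$, $v_{n/2}$ and $w_{n/2}$ are eigenvectors of $H$ and $A_{n/2}$ is the diagonal matrix with the corresponding eigenvalues. *)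

theory Defs
  imports "HOL-Analysis.Analysis"
begin

text \<open>
  A configuration of \<open>n + 1\<close> points of the plane is an element of
  \<^typ>\<open>(real^2)^'b\<close>, where \<open>'b\<close> is a finite index type. The numbering of the
  points by \<open>1, \<dots>, n + 1\<close> is given by a bijection \<open>lab\<close> from \<open>'b\<close> onto
  \<open>{1..n + 1}\<close>; families indexed by \<open>1, \<dots>, n + 1\<close> are transported along it.
\<close>

definition config :: "('b::finite \<Rightarrow> nat) \<Rightarrow> (nat \<Rightarrow> real^2) \<Rightarrow> (real^2)^'b" where
  "config lab x = (\<chi> i. x (lab i))"

definition theta :: "nat \<Rightarrow> real" where
  "theta n = 2 * pi / real n"

definition q_pt :: "nat \<Rightarrow> nat \<Rightarrow> real^2" where
  "q_pt n k = (if k = n + 1 then 0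
               else vector [cos (real k * theta n), sin (real k * theta n)])"

definition tau :: "nat \<Rightarrow> nat \<Rightarrow> real^2" where
  "tau n k = vector [- sin (real k * theta n), cos (real k * theta n)]"

definition z0 :: "('b::finite \<Rightarrow> nat) \<Rightarrow> nat \<Rightarrow> (real^2)^'b" where
  "z0 lab n = config lab (q_pt n)"

definition mass :: "nat \<Rightarrow> real \<Rightarrow> nat \<Rightarrow> real" where
  "mass n m k = (if k = n + 1 then m else 1)"

definition inertia :: "('b::finite \<Rightarrow> nat) \<Rightarrow> nat \<Rightarrow> real \<Rightarrow> (real^2)^'b \<Rightarrow> real" where
  "inertia lab n m z = 1/2 * (\<Sum>i\<in>UNIV. mass n m (lab i) * (norm (z $ i))\<^sup>2)"

text \<open>
  At collisions the next function takes the junk values of division by zero; only its germ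
  at the collision-free configuration \<^const>\<open>z0\<close> is used below.
\<close>

definition potential :: "('b::finite \<Rightarrow> nat) \<Rightarrow> nat \<Rightarrow> real \<Rightarrow> (real^2)^'b \<Rightarrow> real" where
  "potential lab n m z =
     (\<Sum>(i, j) \<in> {(i, j). lab i < lab j}.
        mass n m (lab i) * mass n m (lab j) / norm (z $ i - z $ j))"

definition f_fun :: "('b::finite \<Rightarrow> nat) \<Rightarrow> nat \<Rightarrow> real \<Rightarrow> (real^2)^'b \<Rightarrow> real" where
  "f_fun lab n m z = sqrt (2 * inertia lab n m z) * potential lab n m z"

text \<open>
  The second derivative as a bilinear form, and as the linear operator represented by the
  Hessian matrix, i.e. through the standard (not the mass-weighted) inner product.
\<close>

definition second_derivative ::
    "('a::real_normed_vector \<Rightarrow> real) \<Rightarrow> 'a \<Rightarrow> 'a \<Rightarrow> 'a \<Rightarrow> real" where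
  "second_derivative g z u v =
     frechet_derivative (\<lambda>y. frechet_derivative g (at y) v) (at z) u"

definition hessian :: "('a::euclidean_space \<Rightarrow> real) \<Rightarrow> 'a \<Rightarrow> 'a \<Rightarrow> 'a" where
  "hessian g z u = (\<Sum>b\<in>Basis. second_derivative g z u b *\<^sub>R b)"

definition H_op :: "('b::finite \<Rightarrow> nat) \<Rightarrow> nat \<Rightarrow> real \<Rightarrow> (real^2)^'b \<Rightarrow> (real^2)^'b" where
  "H_op lab n m = hessian (f_fun lab n m) (z0 lab n)"

definition v_vec :: "('b::finite \<Rightarrow> nat) \<Rightarrow> nat \<Rightarrow> nat \<Rightarrow> (real^2)^'b" where
  "v_vec lab n l = config lab (\<lambda>k. if k = n + 1 then 0
                               else cos (real l * real k * theta n) *\<^sub>R q_pt n k)"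

definition v_vec' :: "('b::finite \<Rightarrow> nat) \<Rightarrow> nat \<Rightarrow> nat \<Rightarrow> (real^2)^'b" where
  "v_vec' lab n l = config lab (\<lambda>k. if k = n + 1 then 0
                                else - sin (real l * real k * theta n) *\<^sub>R tau n k)"

definition w_vec :: "('b::finite \<Rightarrow> nat) \<Rightarrow> nat \<Rightarrow> nat \<Rightarrow> (real^2)^'b" where
  "w_vec lab n l = config lab (\<lambda>k. if k = n + 1 then 0
                               else cos (real l * real k * theta n) *\<^sub>R tau n k)"

text \<open>
  \<open>M\<close> is the matrix, in the basis \<open>(x, y)\<close>, of the restriction of \<open>T\<close> to the
  \<open>T\<close>-invariant plane spanned by \<open>x\<close> and \<open>y\<close> (columns are images of basis vectors).
\<close>

definition is_restriction_matrix ::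
    "('a::real_vector \<Rightarrow> 'a) \<Rightarrow> 'a \<Rightarrow> 'a \<Rightarrow> real^2^2 \<Rightarrow> bool" where
  "is_restriction_matrix T x y M \<longleftrightarrow>
     T x = M $ 1 $ 1 *\<^sub>R x + M $ 2 $ 1 *\<^sub>R y \<and>
     T y = M $ 1 $ 2 *\<^sub>R x + M $ 2 $ 2 *\<^sub>R y"

definition is_eigenvalue_matrix ::
    "('a::real_vector \<Rightarrow> 'a) \<Rightarrow> 'a \<Rightarrow> 'a \<Rightarrow> real^2^2 \<Rightarrow> bool" where
  "is_eigenvalue_matrix T x y M \<longleftrightarrow>
     M $ 1 $ 2 = 0 \<and> M $ 2 $ 1 = 0 \<and>
     T x = M $ 1 $ 1 *\<^sub>R x \<and> T y = M $ 2 $ 2 *\<^sub>R y"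

text \<open>
  For \<open>2 \<le> l \<le> n div 2\<close> the second branch below is the case \<open>n\<close> even, \<open>l = n/2\<close>.
\<close>

definition A_mat :: "('b::finite \<Rightarrow> nat) \<Rightarrow> nat \<Rightarrow> nat \<Rightarrow> real \<Rightarrow> real^2^2" where
  "A_mat lab n l m =
     (if 2 * l < n
      then THE M. is_restriction_matrix (H_op lab n m) (v_vec lab n l) (v_vec' lab n l) M
      else THE M. is_eigenvalue_matrix (H_op lab n m) (v_vec lab n l) (w_vec lab n l) M)"

definition I0 :: "nat \<Rightarrow> real" where
  "I0 n = sqrt (real n)"

definition d_poly :: "nat \<Rightarrow> nat \<Rightarrow> nat \<Rightarrow> real" where
  "d_poly n k j = norm (q_pt n k - q_pt n j)"

definition Ue0 :: "nat \<Rightarrow> real" where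
  "Ue0 n = (\<Sum>(k, j) \<in> {(k, j). 1 \<le> k \<and> k < j \<and> j \<le> n}. 1 / d_poly n k j)"

definition U1 :: "nat \<Rightarrow> nat \<Rightarrow> real" where
  "U1 n l = (\<Sum>k=1..n-1.
     (1 - cos (real k * theta n) * cos (real l * real k * theta n)
        - 3 * (cos (real k * theta n) - cos (real l * real k * theta n)))
     / (2 * d_poly n n k ^ 3))"

definition U2 :: "nat \<Rightarrow> nat \<Rightarrow> complex" where
  "U2 n l = (\<Sum>k=1..n-1.
     \<i> * of_real (sin (real k * theta n)) * of_real (sin (real l * real k * theta n))
     / of_real (2 * d_poly n n k ^ 3))"

definition U1' :: "nat \<Rightarrow> nat \<Rightarrow> complex" where
  "U1' n l = (\<Sum>k=1..n-1.
     - \<i> * of_real (sin (real k * theta n)) * of_real (sin (real l * real k * theta n))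
     / of_real (2 * d_poly n n k ^ 3))"

definition U2' :: "nat \<Rightarrow> nat \<Rightarrow> real" where
  "U2' n l = (\<Sum>k=1..n-1.
     (1 - cos (real k * theta n) * cos (real l * real k * theta n)
        + 3 * (cos (real k * theta n) - cos (real l * real k * theta n)))
     / (2 * d_poly n n k ^ 3))"

text \<open>
  The defining expression is real (lemma \<open>of_real_a_coeff\<close>); \<^const>\<open>Re\<close> only changes its type.
\<close>

definition a_coeff :: "nat \<Rightarrow> nat \<Rightarrow> real" where
  "a_coeff n l = Re (of_real ((Ue0 n / I0 n + I0 n * U1 n l) * (Ue0 n / I0 n + I0 n * U2' n l))
                     - of_real ((I0 n)\<^sup>2) * U1' n l * U2 n l)"

lemma of_real_a_coeff:
  "complex_of_real (a_coeff n l) =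
     of_real ((Ue0 n / I0 n + I0 n * U1 n l) * (Ue0 n / I0 n + I0 n * U2' n l))
     - of_real ((I0 n)\<^sup>2) * U1' n l * U2 n l"
proof -
  define S where "S = (\<Sum>k=1..n-1. sin (real k * theta n) * sin (real l * real k * theta n)
     / (2 * d_poly n n k ^ 3))"
  have "U2 n l = \<i> * of_real S" "U1' n l = - \<i> * of_real S"
    unfolding U2_def U1'_def S_def of_real_sum sum_distrib_left by (simp_all add: mult.assoc)
  then have "U1' n l * U2 n l = of_real (S * S)"
    by (simp add: algebra_simps)
  then show ?thesis
    unfolding a_coeff_def by (simp add: mult.assoc)
qed

lemma I0_eq:
  fixes lab :: "'b::finite \<Rightarrow> nat"
  assumes lab: "bij_betw lab UNIV {1..n+1}"
  shows "I0 n = sqrt (2 * inertia lab n m (z0 lab n))"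
proof -
  have "(\<Sum>i\<in>UNIV. mass n m (lab i) * (norm (z0 lab n $ i))\<^sup>2)
      = (\<Sum>k\<in>{1..n+1}. mass n m k * (norm (q_pt n k))\<^sup>2)"
    using sum.reindex_bij_betw[OF lab, of "\<lambda>k. mass n m k * (norm (q_pt n k))\<^sup>2"]
    by (simp add: z0_def config_def)
  also have "\<dots> = (\<Sum>k\<in>{1..n}. 1)"
    by (simp add: mass_def q_pt_def norm_vec_def L2_set_def sum_2)
  finally show ?thesis
    by (simp add: I0_def inertia_def)
qed

lemma d_poly_eq:
  assumes "1 \<le> k" "k \<le> n" "1 \<le> j" "j \<le> n"
  shows "d_poly n k j = 2 * sin (\<bar>real k - real j\<bar> * theta n / 2)"
proof -
  define x where "x = (real k - real j) * theta n / 2"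
  have "(cos (real k * theta n) - cos (real j * theta n))\<^sup>2
      + (sin (real k * theta n) - sin (real j * theta n))\<^sup>2
      = 2 - 2 * cos (real k * theta n - real j * theta n)"
    unfolding cos_diff
    using sin_cos_squared_add[of "real k * theta n"] sin_cos_squared_add[of "real j * theta n"]
    by (simp add: power2_eq_square algebra_simps)
  also have "real k * theta n - real j * theta n = 2 * x"
    unfolding x_def by (simp only: left_diff_distrib) (simp add: diff_divide_distrib)
  also have "2 - 2 * cos (2 * x) = (2 * sin x)\<^sup>2"
    by (simp add: cos_double_sin power_mult_distrib)
  finally have "d_poly n k j = \<bar>2 * sin x\<bar>"
    using assms by (simp add: d_poly_def q_pt_def norm_vec_def L2_set_def sum_2 real_sqrt_mult)
  also have "\<dots> = 2 * \<bar>sin \<bar>x\<bar>\<bar>"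
    by (simp add: abs_if)
  also have "\<bar>x\<bar> = \<bar>real k - real j\<bar> * theta n / 2"
    by (simp add: x_def theta_def abs_mult)
  also have "\<bar>sin (\<bar>real k - real j\<bar> * theta n / 2)\<bar> = sin (\<bar>real k - real j\<bar> * theta n / 2)"
  proof -
    have "\<bar>real k - real j\<bar> \<le> real n" using assms by linarith
    then have "\<bar>real k - real j\<bar> * theta n / 2 \<le> pi"
      using assms by (simp add: theta_def field_simps)
    then show ?thesis
      by (intro abs_of_nonneg sin_ge_zero) (auto simp: theta_def)
  qed
  finally show ?thesis .
qed

end

theory Submission
  imports Defs
begin

text \<open>
  Write \<open>f = g U\<close> with \<open>g = \<surd>(2 I)\<close>. On a perturbation orthogonal to \<open>\<nabla>I\<close> and \<open>\<nabla>U\<close>, all mixed terms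
  of the product rule vanish and \<open>H\<close> becomes \<open>(U / g)\<close> times the mass matrix plus \<open>g D\<^sup>2U\<close>. For the two
  families \<open>cos (l k \<theta> + \<phi>) q\<^sub>k\<close> and \<open>cos (l k \<theta> + \<phi>) \<tau>\<^sub>k\<close> the sum over the ring is invariant under
  rotation of the summation index and its odd part cancels, which leaves \<open>U\<^sub>l\<^sub>1\<close>, \<open>U'\<^sub>l\<^sub>2\<close> and the sine
  sum \<open>S\<close> with \<open>U'\<^sub>l\<^sub>1 U\<^sub>l\<^sub>2 = S\<^sup>2\<close>. The centre contributes \<open>2 m\<close> radially and \<open>- m\<close> tangentially, and the
  latter cancels against the \<open>n m / I\<^sub>0 = I\<^sub>0 m\<close> coming from \<open>U / g\<close>. Hence \<open>det A\<^sub>l\<close> is affine in \<open>m\<close>,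
  namely \<open>a\<^sub>l + 3 I\<^sub>0 (U\<^sub>e\<^sub>0 / I\<^sub>0 + I\<^sub>0 U'\<^sub>l\<^sub>2) m\<close>.
\<close>

section \<open>Newtonian kernel and Hessians from gradients\<close>

text \<open>Minus the gradient of \<open>1 / norm\<close>. The next definition is the derivative of
  this field, so minus the second derivative of the Newtonian potential.\<close>

definition kern :: "'a::real_inner \<Rightarrow> 'a" where
  "kern x = (1 / norm x ^ 3) *\<^sub>R x"

definition dkern :: "'a::real_inner \<Rightarrow> 'a \<Rightarrow> 'a" where
  "dkern x w = (1 / norm x ^ 3) *\<^sub>R w - (3 * (x \<bullet> w) / norm x ^ 5) *\<^sub>R x"

lemma has_derivative_inverse_norm:
  fixes x :: "'a::real_inner"
  assumes "x \<noteq> 0"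
  shows "((\<lambda>y. 1 / norm y) has_derivative (\<lambda>w. - (kern x \<bullet> w))) (at x)"
proof -
  have "norm x \<noteq> 0" using assms by simp
  have "((\<lambda>y. 1 / norm y) has_derivative (\<lambda>w. - 1 * (inverse (norm x) * (sgn x \<bullet> w) * inverse (norm x)) + 0 / norm x)) (at x)"
    by (rule has_derivative_eq_rhs, rule derivative_eq_intros refl has_derivative_norm assms | simp add: assms inner_commute)+
  moreover have "- 1 * (inverse (norm x) * (sgn x \<bullet> w) * inverse (norm x)) + 0 / norm x = - (kern x \<bullet> w)" for w
    using assms by (simp add: kern_def sgn_div_norm field_simps power3_eq_cube)
  ultimately show ?thesis by simp
qed

lemma has_derivative_kern:
  fixes x :: "'a::real_inner"
  assumes "x \<noteq> 0"
  shows "(kern has_derivative dkern x) (at x)"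
proof -
  have "((\<lambda>y. (1 / norm y) ^ 3 *\<^sub>R y) has_derivative
     (\<lambda>w. (1 / norm x) ^ 3 *\<^sub>R w + (3 * - (kern x \<bullet> w) * (1 / norm x) ^ 2) *\<^sub>R x)) (at x)"
    by (rule has_derivative_eq_rhs[OF has_derivative_scaleR
          [OF has_derivative_power[OF has_derivative_inverse_norm[OF assms]] has_derivative_ident]])
      (simp add: mult_ac)
  moreover have "(1 / norm x) ^ 3 *\<^sub>R w + (3 * - (kern x \<bullet> w) * (1 / norm x) ^ 2) *\<^sub>R x = dkern x w" for w
    using assms by (simp add: dkern_def kern_def power_one_over field_simps eval_nat_numeral)
  ultimately show ?thesis by (simp add: kern_def[abs_def] power_one_over)
qed

lemma has_derivative_vec_lambda:
  fixes F :: "'i::finite \<Rightarrow> 'a::real_normed_vector \<Rightarrow> 'c::euclidean_space"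
  assumes "\<And>i. (F i has_derivative F' i) (at x)"
  shows "((\<lambda>y. \<chi> i. F i y) has_derivative (\<lambda>w. \<chi> i. F' i w)) (at x)"
  unfolding has_derivative_componentwise_within[of "\<lambda>y. \<chi> i. F i y"]
proof
  fix b :: "'c^'i" assume "b \<in> Basis"
  then obtain i c where "b = axis i c" by (auto simp: Basis_vec_def)
  then show "((\<lambda>y. (\<chi> i. F i y) \<bullet> b) has_derivative (\<lambda>w. (\<chi> i. F' i w) \<bullet> b)) (at x)"
    using assms by (auto simp: inner_axis intro!: derivative_intros)
qed

text \<open>\<open>hessian\<close> iterates \<open>frechet_derivative\<close>, so the inner
  derivative has to be known around \<open>z\<close> and not only at \<open>z\<close>; hence a
  gradient formula on an open set.\<close>

lemma hessian_eq_gradient_derivative: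
  fixes g :: "'a::euclidean_space \<Rightarrow> real"
  assumes "open S" "z \<in> S"
    and grad: "\<And>y. y \<in> S \<Longrightarrow> (g has_derivative (\<lambda>v. G y \<bullet> v)) (at y)"
    and G: "(G has_derivative G') (at z)"
  shows "hessian g z u = G' u"
proof -
  have "second_derivative g z u b = G' u \<bullet> b" for b
  proof -
    have "((\<lambda>y. G y \<bullet> b) has_derivative (\<lambda>w. G' w \<bullet> b)) (at z)"
      using G by (auto intro!: derivative_eq_intros)
    \<comment> \<open>Frechet derivatives are unique, so \<open>G\<close> represents the inner
      derivative throughout \<open>S\<close>.\<close>
    moreover have "G y \<bullet> b = frechet_derivative g (at y) b" if "y \<in> S" for y
      using frechet_derivative_at[OF grad[OF that]] by metis
    ultimately have "((\<lambda>y. frechet_derivative g (at y) b) has_derivative (\<lambda>w. G' w \<bullet> b)) (at z)"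
      by (rule has_derivative_transform_within_open[OF _ assms(1,2)])
    then show ?thesis
      unfolding second_derivative_def by (metis (no_types) frechet_derivative_at)
  qed
  then show ?thesis
    by (simp add: hessian_def euclidean_representation)
qed

section \<open>Second derivative of the normalised potential\<close>

definition mass_op :: "('b::finite \<Rightarrow> nat) \<Rightarrow> nat \<Rightarrow> real \<Rightarrow> (real^2)^'b \<Rightarrow> (real^2)^'b" where
  "mass_op lab n m z = (\<chi> i. mass n m (lab i) *\<^sub>R z $ i)"

text \<open>The terms \<open>i = j\<close> of the sums below vanish because \<open>kern 0 = 0\<close> and \<open>dkern 0 w = 0\<close>.\<close>

definition grad_U :: "('b::finite \<Rightarrow> nat) \<Rightarrow> nat \<Rightarrow> real \<Rightarrow> (real^2)^'b \<Rightarrow> (real^2)^'b" where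
  "grad_U lab n m z =
     (\<chi> i. - (\<Sum>j\<in>UNIV. (mass n m (lab i) * mass n m (lab j)) *\<^sub>R kern (z $ i - z $ j)))"

definition hess_U ::
    "('b::finite \<Rightarrow> nat) \<Rightarrow> nat \<Rightarrow> real \<Rightarrow> (real^2)^'b \<Rightarrow> (real^2)^'b \<Rightarrow> (real^2)^'b" where
  "hess_U lab n m z u =
     (\<chi> i. - (\<Sum>j\<in>UNIV. (mass n m (lab i) * mass n m (lab j)) *\<^sub>R dkern (z $ i - z $ j) (u $ i - u $ j)))"

definition collision_free :: "('a^'b::finite) set" where
  "collision_free = {z. \<forall>i j. i \<noteq> j \<longrightarrow> z $ i \<noteq> z $ j}"

lemma open_collision_free: "open (collision_free :: ('a::t2_space^'b::finite) set)"
proof -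
  have "collision_free = (\<Inter>i. \<Inter>j\<in>-{i}. {z :: 'a^'b. z $ i \<noteq> z $ j})"
    by (auto simp: collision_free_def)
  moreover have "open \<dots>"
    by (intro open_INT finite ballI open_Collect_neq continuous_intros)
  ultimately show ?thesis by simp
qed

lemma kern_zero [simp]: "kern 0 = 0"
  by (simp add: kern_def)

lemma dkern_zero [simp]: "dkern 0 w = 0"
  by (simp add: dkern_def)

lemma kern_minus: "kern (- x) = - kern x"
  by (simp add: kern_def)

lemma has_derivative_vec_nth: "((\<lambda>y. y $ i) has_derivative (\<lambda>w. w $ i)) F"
  by (rule bounded_linear_imp_has_derivative[OF bounded_linear_vec_nth])

lemma inner_vec_lambda: "(\<chi> i. x i) \<bullet> y = (\<Sum>i\<in>UNIV. x i \<bullet> y $ i)"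
  by (simp add: inner_vec_def)

lemma has_derivative_pair_inverse_norm:
  fixes z :: "(real^2)^'b::finite"
  assumes "z \<in> collision_free"
  shows "((\<lambda>y. 1 / norm (y $ i - y $ j)) has_derivative
           (\<lambda>v. - (kern (z $ i - z $ j) \<bullet> (v $ i - v $ j)))) (at z)"
proof (cases "i = j")
  case False
  then have "z $ i - z $ j \<noteq> 0"
    using assms by (auto simp: collision_free_def)
  from has_derivative_inverse_norm[OF this] show ?thesis
    by (rule has_derivative_compose[rotated]) (intro has_derivative_diff has_derivative_vec_nth)
qed simp

lemma has_derivative_pair_kern:
  fixes z :: "(real^2)^'b::finite"
  assumes "z \<in> collision_free"
  shows "((\<lambda>y. kern (y $ i - y $ j)) has_derivative
           (\<lambda>v. dkern (z $ i - z $ j) (v $ i - v $ j))) (at z)"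
proof (cases "i = j")
  case False
  then have "z $ i - z $ j \<noteq> 0"
    using assms by (auto simp: collision_free_def)
  from has_derivative_kern[OF this] show ?thesis
    by (rule has_derivative_compose[rotated]) (intro has_derivative_diff has_derivative_vec_nth)
qed simp

text \<open>Swapping the two indices preserves the summand and exchanges the two strict orders of
  the labels. The symmetric form can be differentiated without regard to that order.\<close>

lemma potential_symmetric:
  assumes "inj lab"
  shows "potential lab n m z =
    1/2 * (\<Sum>i\<in>UNIV. \<Sum>j\<in>UNIV. (mass n m (lab i) * mass n m (lab j)) * (1 / norm (z $ i - z $ j)))"
proof -
  define h where "h = (\<lambda>(i, j). mass n m (lab i) * mass n m (lab j) / norm (z $ i - z $ j))"
  define L where "L = {(i, j). lab i < lab j}"
  define R where "R = {(i, j). lab j < lab i}"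
  have "R = prod.swap ` L"
    by (auto simp: L_def R_def)
  moreover have "h (prod.swap p) = h p" for p
    by (cases p) (simp add: h_def mult.commute norm_minus_commute)
  ultimately have "sum h R = sum h L"
    by (simp add: sum.reindex)
  have "(\<Sum>i\<in>UNIV. \<Sum>j\<in>UNIV. (mass n m (lab i) * mass n m (lab j)) * (1 / norm (z $ i - z $ j)))
      = sum h UNIV"
    by (simp add: h_def sum.cartesian_product)
  also have "\<dots> = sum h (L \<union> R)"
  proof (rule sum.mono_neutral_right)
    \<comment> \<open>Outside \<open>L\<close> and \<open>R\<close> injectivity forces i = j, where
      the summand is a division by zero and hence 0.\<close>
    show "\<forall>p\<in>UNIV - (L \<union> R). h p = 0"
      using assms by (auto simp: L_def R_def h_def not_less inj_eq dest!: antisym)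
  qed auto
  also have "\<dots> = sum h L + sum h R"
    by (rule sum.union_disjoint) (auto simp: L_def R_def)
  finally show ?thesis
    using \<open>sum h R = sum h L\<close> by (simp add: potential_def h_def L_def)
qed

text \<open>The pair forces \<open>K\<close> are antisymmetric (action equals reaction), so the
  terms with \<open>v $ j\<close> and those with \<open>v $ i\<close> contribute equally and absorb
  the factor 1/2.\<close>

lemma has_derivative_potential:
  assumes "inj lab" "z \<in> collision_free"
  shows "(potential lab n m has_derivative (\<lambda>v. grad_U lab n m z \<bullet> v)) (at z)"
proof -
  define K where "K = (\<lambda>i j. (mass n m (lab i) * mass n m (lab j)) *\<^sub>R kern (z $ i - z $ j))"
  have "((\<lambda>z. 1/2 * (\<Sum>i\<in>UNIV. \<Sum>j\<in>UNIV. (mass n m (lab i) * mass n m (lab j)) * (1 / norm (z $ i - z $ j))))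
      has_derivative (\<lambda>v. 1/2 * (\<Sum>i\<in>UNIV. \<Sum>j\<in>UNIV. (mass n m (lab i) * mass n m (lab j)) *
         (- (kern (z $ i - z $ j) \<bullet> (v $ i - v $ j)))))) (at z)"
    by (intro has_derivative_mult_right has_derivative_sum has_derivative_pair_inverse_norm assms)
  moreover have "1/2 * (\<Sum>i\<in>UNIV. \<Sum>j\<in>UNIV. (mass n m (lab i) * mass n m (lab j)) *
         (- (kern (z $ i - z $ j) \<bullet> (v $ i - v $ j)))) = grad_U lab n m z \<bullet> v" for v
  proof -
    have grad: "grad_U lab n m z = (\<chi> i. - (\<Sum>j\<in>UNIV. K i j))"
      by (simp add: grad_U_def K_def)
    have K: "K j i = - K i j" for i j
      using kern_minus[of "z $ i - z $ j"] by (simp add: K_def mult.commute)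
    have "(\<Sum>i\<in>UNIV. \<Sum>j\<in>UNIV. (mass n m (lab i) * mass n m (lab j)) *
         (- (kern (z $ i - z $ j) \<bullet> (v $ i - v $ j))))
      = (\<Sum>i\<in>UNIV. \<Sum>j\<in>UNIV. K i j \<bullet> v $ j) - (\<Sum>i\<in>UNIV. \<Sum>j\<in>UNIV. K i j \<bullet> v $ i)"
      by (simp add: K_def inner_diff_right sum_subtractf[symmetric] right_diff_distrib)
    also have "(\<Sum>i\<in>UNIV. \<Sum>j\<in>UNIV. K i j \<bullet> v $ j) = (\<Sum>i\<in>UNIV. \<Sum>j\<in>UNIV. K j i \<bullet> v $ i)"
      by (rule sum.swap)
    also have "\<dots> = - (\<Sum>i\<in>UNIV. \<Sum>j\<in>UNIV. K i j \<bullet> v $ i)"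
      by (subst K) (simp add: sum_negf)
    finally show ?thesis
      by (simp add: grad inner_vec_lambda inner_sum_left sum_negf)
  qed
  ultimately show ?thesis
    by (simp add: potential_symmetric[OF assms(1), abs_def])
qed

lemma has_derivative_grad_U:
  assumes "z \<in> collision_free"
  shows "(grad_U lab n m has_derivative hess_U lab n m z) (at z)"
  unfolding grad_U_def[abs_def] hess_U_def[abs_def]
  by (intro has_derivative_vec_lambda has_derivative_minus has_derivative_sum
        has_derivative_scaleR_right has_derivative_pair_kern assms)

lemma has_derivative_inertia:
  "(inertia lab n m has_derivative (\<lambda>v. mass_op lab n m z \<bullet> v)) (at z)"
proof -
  have "((\<lambda>z. 1/2 * (\<Sum>i\<in>UNIV. mass n m (lab i) * (z $ i \<bullet> z $ i))) has_derivative
      (\<lambda>v. 1/2 * (\<Sum>i\<in>UNIV. mass n m (lab i) * (z $ i \<bullet> v $ i + v $ i \<bullet> z $ i)))) (at z)"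
    by (intro has_derivative_mult_right has_derivative_sum has_derivative_inner has_derivative_vec_nth)
  moreover have "1/2 * (\<Sum>i\<in>UNIV. mass n m (lab i) * (z $ i \<bullet> v $ i + v $ i \<bullet> z $ i))
      = mass_op lab n m z \<bullet> v" for v
    by (simp only: mass_op_def inner_vec_lambda sum_distrib_left) (simp add: inner_commute)
  ultimately show ?thesis
    by (simp add: inertia_def[abs_def] power2_norm_eq_inner)
qed

lemma has_derivative_sqrt_inertia:
  assumes "inertia lab n m z > 0"
  shows "((\<lambda>y. sqrt (2 * inertia lab n m y)) has_derivative
           (\<lambda>v. mass_op lab n m z \<bullet> v / sqrt (2 * inertia lab n m z))) (at z)"
  using assms
  by (auto intro!: derivative_eq_intros has_derivative_inertia simp: field_simps)

lemma has_derivative_mass_op: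
  "(mass_op lab n m has_derivative mass_op lab n m) (at z)"
  unfolding mass_op_def[abs_def]
  by (intro has_derivative_vec_lambda has_derivative_scaleR_right has_derivative_vec_nth)

lemma hessian_f_fun:
  fixes lab :: "'b::finite \<Rightarrow> nat"
  assumes "inj lab" "z \<in> collision_free" "inertia lab n m z > 0"
    and "mass_op lab n m z \<bullet> u = 0" "grad_U lab n m z \<bullet> u = 0"
  shows "hessian (f_fun lab n m) z u =
    (potential lab n m z / sqrt (2 * inertia lab n m z)) *\<^sub>R mass_op lab n m u
    + sqrt (2 * inertia lab n m z) *\<^sub>R hess_U lab n m z u"
proof -
  define s where "s = (\<lambda>y. sqrt (2 * inertia lab n m y))"
  \<comment> \<open>\<open>mass_op\<close> is the gradient of the inertia, so
    \<open>mass_op lab n m y\<close> divided by \<open>s y\<close> is the gradient of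
    \<open>s\<close>; by the product rule \<open>G\<close> is the gradient of
    \<open>f_fun\<close>.\<close>
  define G where "G = (\<lambda>y. (potential lab n m y / s y) *\<^sub>R mass_op lab n m y + s y *\<^sub>R grad_U lab n m y)"
  \<comment> \<open>Positive inertia keeps the square root differentiable, and both conditions are
    open.\<close>
  define S where "S = collision_free \<inter> {y. inertia lab n m y > 0}"
  have ds: "(s has_derivative (\<lambda>v. mass_op lab n m y \<bullet> v / s y)) (at y)"
    if "inertia lab n m y > 0" for y
    using has_derivative_sqrt_inertia[OF that] by (simp add: s_def)
  have "s z \<noteq> 0"
    using assms by (simp add: s_def)
  have "continuous_on UNIV (inertia lab n m)"
    by (auto intro!: continuous_at_imp_continuous_on has_derivative_continuous has_derivative_inertia)
  then have "open S"
    unfolding S_def by (intro open_Int open_collision_free open_Collect_less continuous_on_const)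
  moreover have "z \<in> S"
    using assms by (simp add: S_def)
  moreover have "(f_fun lab n m has_derivative (\<lambda>v. G y \<bullet> v)) (at y)" if "y \<in> S" for y
  proof -
    have y: "y \<in> collision_free" "inertia lab n m y > 0"
      using that by (auto simp: S_def)
    show ?thesis
      using has_derivative_mult[OF ds[OF y(2)] has_derivative_potential[OF assms(1) y(1)]]
      by (simp add: f_fun_def[abs_def] s_def G_def inner_add_left mult_ac add.commute)
  qed
  moreover have "(G has_derivative (\<lambda>w.
      (potential lab n m z / s z) *\<^sub>R mass_op lab n m w
      + ((grad_U lab n m z \<bullet> w * s z - potential lab n m z * (mass_op lab n m z \<bullet> w / s z)) / (s z * s z))
          *\<^sub>R mass_op lab n m z
      + (s z *\<^sub>R hess_U lab n m z w + (mass_op lab n m z \<bullet> w / s z) *\<^sub>R grad_U lab n m z))) (at z)"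
    unfolding G_def
    by (intro has_derivative_add has_derivative_scaleR has_derivative_divide' ds
        has_derivative_mass_op has_derivative_grad_U has_derivative_potential assms \<open>s z \<noteq> 0\<close>)
  ultimately have "hessian (f_fun lab n m) z u =
      (potential lab n m z / s z) *\<^sub>R mass_op lab n m u
      + ((grad_U lab n m z \<bullet> u * s z - potential lab n m z * (mass_op lab n m z \<bullet> u / s z)) / (s z * s z))
          *\<^sub>R mass_op lab n m z
      + (s z *\<^sub>R hess_U lab n m z u + (mass_op lab n m z \<bullet> u / s z) *\<^sub>R grad_U lab n m z)"
    by (rule hessian_eq_gradient_derivative)
  then show ?thesis
    using assms(4,5) by (simp add: s_def)
qed

section \<open>Sums of periodic functions over the ring\<close>

text \<open>The terms are real parts of a rotated geometric progression in the root of unity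
  \<open>z\<close>; its sum vanishes because \<open>z ^ n = 1\<close> while
  \<open>z \<noteq> 1\<close>.\<close>

lemma sum_cos_progression_eq_0:
  assumes "0 < r" "r < n"
  shows "(\<Sum>k=1..n. cos (real r * real k * theta n + \<phi>)) = 0"
proof -
  define z where "z = cis (real r * theta n)"
  have "z \<noteq> 1"
  proof
    assume "z = 1"
    \<comment> \<open>Otherwise r \<theta> would be a whole number of turns and n would divide r,
      against 0 < r < n.\<close>
    then have "cos (real r * theta n) = 1"
      by (simp add: z_def complex_eq_iff)
    then obtain i :: int where "real r * theta n = of_int i * 2 * pi"
      by (auto simp: cos_one_2pi_int)
    then have "real r = of_int i * real n"
      using assms by (simp add: theta_def field_simps)
    then have "int r = i * int n"
      by (metis of_int_eq_iff of_int_mult of_int_of_nat_eq)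
    then have "int n dvd int r" by simp
    then show False
      using assms by (auto dest: nat_dvd_not_less)
  qed
  have "z ^ n = cis (2 * pi * real r)"
    unfolding z_def Complex.DeMoivre using assms by (intro arg_cong[of _ _ cis]) (simp add: theta_def)
  then have "z ^ n = 1" by simp
  have "(\<Sum>k=1..n. cis (real r * real k * theta n + \<phi>)) = (\<Sum>k=1..n. cis \<phi> * z ^ k)"
    by (intro sum.cong refl) (simp add: z_def Complex.DeMoivre cis_mult algebra_simps)
  also have "\<dots> = cis \<phi> * (\<Sum>k=1..n. z ^ k)"
    by (simp add: sum_distrib_left)
  also have "(\<Sum>k=1..n. z ^ k) = 0"
    using \<open>z ^ n = 1\<close> \<open>z \<noteq> 1\<close> assms by (simp add: sum_gp)
  finally have "Re (\<Sum>k=1..n. cis (real r * real k * theta n + \<phi>)) = 0" by simp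
  then show ?thesis by simp
qed

text \<open>Changing the shift by one exchanges only boundary terms, which agree by periodicity.
  Integer arguments accommodate negative differences j - k.\<close>

lemma periodic_sum_shift:
  fixes G :: "int \<Rightarrow> 'a::ab_group_add"
  assumes "\<And>x. G (x + int n) = G x"
  shows "(\<Sum>j=1..n. G (int j - int k)) = (\<Sum>j=1..n. G (int j))"
proof (induction k)
  case (Suc k)
  define F where "F = (\<lambda>j. G (int j - int (Suc k)))"
  have "F (n + 1) = F 1" 
    using assms[of "- int k"] by (simp add: F_def algebra_simps)
  then have "(\<Sum>j=1..n. F j) = (\<Sum>j=1..n. F (Suc j))"
    using sum_Suc_diff'[of 1 "n+1" F] by (simp add: atLeastLessThanSuc_atLeastAtMost sum_subtractf)
  then show ?case
    using Suc by (simp add: F_def algebra_simps)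
qed simp

text \<open>Reversing the index range and shifting it back by one turns the sum into its own
  negative.\<close>

lemma odd_periodic_sum_eq_0:
  fixes G :: "int \<Rightarrow> real"
  assumes "\<And>x. G (x + int n) = G x" "\<And>x. G (- x) = - G x"
  shows "(\<Sum>j=1..n. G (int j)) = 0"
proof -
  have "(\<Sum>j=1..n. G (int j)) = (\<Sum>j=1..n. G (int (n + 1 - j)))"
    by (rule sum.atLeastAtMost_rev)
  also have "\<dots> = (\<Sum>j=1..n. - G (int j - int 1))"
  proof (rule sum.cong[OF refl])
    fix j assume "j \<in> {1..n}"
    then show "G (int (n + 1 - j)) = - G (int j - int 1)"
      using assms(1)[of "- (int j - 1)"] assms(2)[of "int j - 1"] by (simp add: of_nat_diff algebra_simps)
  qed
  also have "\<dots> = - (\<Sum>j=1..n. G (int j))"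
    using periodic_sum_shift[of G n 1] assms(1) by (simp add: sum_negf)
  finally show ?thesis by simp
qed

section \<open>Forces of the ring\<close>

text \<open>The primed frame is the orthonormal frame \<open>q\<close>, \<open>t\<close> turned by
  \<delta>. The squared chord is 2 (1 - cos \<delta>), so a factor 1 - cos \<delta> in the numerator
  reduces the fifth power of the distance in \<open>dkern\<close> to the third power that occurs in
  \<open>U1\<close> and \<open>U2'\<close>.\<close>

lemma rotated_frame:
  fixes q t :: "'a::real_inner"
  assumes frame: "q \<bullet> q = 1" "t \<bullet> t = 1" "q \<bullet> t = 0"
    and q': "q' = cos \<delta> *\<^sub>R q + sin \<delta> *\<^sub>R t"
    and t': "t' = cos \<delta> *\<^sub>R t - sin \<delta> *\<^sub>R q"
  shows norm_rotated_frame: "norm (q - q') = sqrt (2 - 2 * cos \<delta>)"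
    and dkern_radial: "dkern (q - q') (a *\<^sub>R q - b *\<^sub>R q') =
      (1 / (2 * norm (q - q') ^ 3)) *\<^sub>R
        (((3 * a + b) * sin \<delta>) *\<^sub>R t - (a + 3 * b - (3 * a + b) * cos \<delta>) *\<^sub>R q)"
    and dkern_tangential: "dkern (q - q') (a *\<^sub>R t - b *\<^sub>R t') =
      (1 / (2 * norm (q - q') ^ 3)) *\<^sub>R
        (((3 * a - b) * sin \<delta>) *\<^sub>R q - (a - 3 * b + (3 * a - b) * cos \<delta>) *\<^sub>R t)"
proof -
  define d where "d = norm (q - q')"
  have t_q: "t \<bullet> q = 0" using frame by (simp add: inner_commute)
  have x: "q - q' = (1 - cos \<delta>) *\<^sub>R q - sin \<delta> *\<^sub>R t"
    by (simp add: q' algebra_simps)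
  have "d\<^sup>2 = (q - q') \<bullet> (q - q')"
    by (simp add: d_def power2_norm_eq_inner)
  also have "\<dots> = (1 - cos \<delta>)\<^sup>2 + (sin \<delta>)\<^sup>2"
    unfolding x by (simp add: inner_diff_left inner_diff_right frame t_q power2_eq_square)
  also have "\<dots> = 2 - 2 * cos \<delta>"
    by (simp add: sin_squared_eq power2_eq_square algebra_simps)
  finally have d2: "d\<^sup>2 = 2 - 2 * cos \<delta>" .
  have "d \<ge> 0" by (simp add: d_def)
  then show "norm (q - q') = sqrt (2 - 2 * cos \<delta>)"
    unfolding d2[symmetric] by (simp add: d_def)
  have s2: "sin \<delta> * sin \<delta> = (1 - cos \<delta>) * (1 + cos \<delta>)"
    using sin_cos_squared_add[of \<delta>] by (simp add: power2_eq_square algebra_simps)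
  \<comment> \<open>\<open>A\<close> is the quotient that remains after this reduction, posed as a
    product to avoid dividing by 1 - cos \<delta>. For a degenerate chord both sides are 0 by the
    division convention.\<close>
  have dk: "dkern (q - q') w = (1 / (2 * norm (q - q') ^ 3)) *\<^sub>R
      ((2 * \<beta> + A * sin \<delta>) *\<^sub>R t - (A * (1 - cos \<delta>) - 2 * \<alpha>) *\<^sub>R q)"
    if w: "w = \<alpha> *\<^sub>R q + \<beta> *\<^sub>R t" and A: "A * (1 - cos \<delta>) = 3 * ((q - q') \<bullet> w)" for w A \<alpha> \<beta>
  proof (cases "d = 0")
    case False
    have "A * d\<^sup>2 = 6 * ((q - q') \<bullet> w)"
      using A by (simp add: d2 algebra_simps)
    then have "3 * ((q - q') \<bullet> w) / d ^ 5 = A / (2 * d ^ 3)"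
      using False by (simp add: field_simps eval_nat_numeral)
    then have "dkern (q - q') w = (1 / (2 * d ^ 3)) *\<^sub>R (2 *\<^sub>R w - A *\<^sub>R (q - q'))"
      unfolding dkern_def d_def[symmetric] by (simp add: scaleR_diff_right)
    moreover have "2 *\<^sub>R w - A *\<^sub>R (q - q') =
        (2 * \<beta> + A * sin \<delta>) *\<^sub>R t - (A * (1 - cos \<delta>) - 2 * \<alpha>) *\<^sub>R q"
      unfolding w x by (simp add: algebra_simps)
    ultimately show ?thesis
      by (simp add: d_def)
  qed (simp add: d_def)
  have w: "a *\<^sub>R q - b *\<^sub>R q' = (a - b * cos \<delta>) *\<^sub>R q + (- b * sin \<delta>) *\<^sub>R t"
    by (simp add: q' algebra_simps)
  have "(q - q') \<bullet> (a *\<^sub>R q - b *\<^sub>R q') = (1 - cos \<delta>) * (a - b * cos \<delta>) + b * (sin \<delta> * sin \<delta>)"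
    unfolding x w by (simp add: inner_simps frame t_q)
  \<comment> \<open>The identity \<open>s2\<close> exposes the factor 1 - cos \<delta>, so 3 (a + b)
    serves as \<open>A\<close>.\<close>
  also have "\<dots> = (1 - cos \<delta>) * (a + b)"
    unfolding s2 by (simp add: algebra_simps)
  finally have "3 * (a + b) * (1 - cos \<delta>) = 3 * ((q - q') \<bullet> (a *\<^sub>R q - b *\<^sub>R q'))"
    by simp
  moreover have "2 * (- b * sin \<delta>) + 3 * (a + b) * sin \<delta> = (3 * a + b) * sin \<delta>"
    "3 * (a + b) * (1 - cos \<delta>) - 2 * (a - b * cos \<delta>) = a + 3 * b - (3 * a + b) * cos \<delta>"
    by (simp_all add: algebra_simps)
  ultimately show "dkern (q - q') (a *\<^sub>R q - b *\<^sub>R q') =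
      (1 / (2 * norm (q - q') ^ 3)) *\<^sub>R
        (((3 * a + b) * sin \<delta>) *\<^sub>R t - (a + 3 * b - (3 * a + b) * cos \<delta>) *\<^sub>R q)"
    using dk[OF w, of "3 * (a + b)"] by simp
  have w: "a *\<^sub>R t - b *\<^sub>R t' = (b * sin \<delta>) *\<^sub>R q + (a - b * cos \<delta>) *\<^sub>R t"
    by (simp add: t' algebra_simps)
  have xw: "(q - q') \<bullet> (a *\<^sub>R t - b *\<^sub>R t') = (b - a) * sin \<delta>"
    unfolding x w by (simp add: inner_simps frame t_q algebra_simps)
  show "dkern (q - q') (a *\<^sub>R t - b *\<^sub>R t') =
      (1 / (2 * norm (q - q') ^ 3)) *\<^sub>R
        (((3 * a - b) * sin \<delta>) *\<^sub>R q - (a - 3 * b + (3 * a - b) * cos \<delta>) *\<^sub>R t)"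
  proof (cases "d = 0")
    case False
    then have nz: "1 - cos \<delta> \<noteq> 0" using d2 by auto
    \<comment> \<open>Here the inner product shows no factor 1 - cos \<delta>, so the quotient
      itself serves as \<open>A\<close>; multiplied by sin \<delta> it becomes polynomial in cos
      \<delta>.\<close>
    define r where "r = 3 * ((b - a) * sin \<delta>) / (1 - cos \<delta>)"
    have r: "r * (1 - cos \<delta>) = 3 * ((b - a) * sin \<delta>)"
      using nz by (simp add: r_def)
    have "r * sin \<delta> * (1 - cos \<delta>) = r * (1 - cos \<delta>) * sin \<delta>"
      by simp
    also have "\<dots> = 3 * (b - a) * (sin \<delta> * sin \<delta>)"
      unfolding r by simp
    finally have rs: "r * sin \<delta> = 3 * (b - a) * (1 + cos \<delta>)"
      unfolding s2 using nz by simp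
    have "(2 * (a - b * cos \<delta>) + r * sin \<delta>) *\<^sub>R t - (r * (1 - cos \<delta>) - 2 * (b * sin \<delta>)) *\<^sub>R q
       = ((3 * a - b) * sin \<delta>) *\<^sub>R q - (a - 3 * b + (3 * a - b) * cos \<delta>) *\<^sub>R t"
    proof -
      have "2 * (a - b * cos \<delta>) + r * sin \<delta> = - (a - 3 * b + (3 * a - b) * cos \<delta>)"
        "r * (1 - cos \<delta>) - 2 * (b * sin \<delta>) = - ((3 * a - b) * sin \<delta>)"
        unfolding r rs by (simp_all add: algebra_simps)
      then show ?thesis by (simp only: scaleR_minus_left) simp
    qed
    then show ?thesis
      using dk[OF w, of r] r xw by simp
  qed (simp add: d_def)
qed

text \<open>\<open>weight n 0 = 0\<close> by division by zero, so sums over the ring need not exclude coincident indices.\<close>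

definition weight :: "nat \<Rightarrow> int \<Rightarrow> real" where
  "weight n s = 1 / (2 * sqrt (2 - 2 * cos (of_int s * theta n)) ^ 3)"

text \<open>\<open>U2\<close> is i times this sum and \<open>U1'\<close> is -i times it; it measures
  the coupling between radial and tangential modes.\<close>

definition S_coeff :: "nat \<Rightarrow> nat \<Rightarrow> real" where
  "S_coeff n l = (\<Sum>k=1..n. weight n (int k) * (sin (real k * theta n) * sin (real l * real k * theta n)))"

lemma
  assumes "n > 0"
  shows cos_theta_periodic: "cos (real l * of_int (x + int n) * theta n) = cos (real l * of_int x * theta n)"
    and sin_theta_periodic: "sin (real l * of_int (x + int n) * theta n) = sin (real l * of_int x * theta n)"
proof -
  have *: "real l * of_int (x + int n) * theta n = real l * of_int x * theta n + 2 * real l * pi"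
    using assms by (simp add: theta_def field_simps)
  show "cos (real l * of_int (x + int n) * theta n) = cos (real l * of_int x * theta n)"
    "sin (real l * of_int (x + int n) * theta n) = sin (real l * of_int x * theta n)"
    unfolding * cos_add sin_add cos_2npi sin_2npi by simp_all
qed

lemma weight_periodic: "n > 0 \<Longrightarrow> weight n (x + int n) = weight n x"
  using cos_theta_periodic[of n 1 x] by (simp add: weight_def)

lemma weight_even: "weight n (- x) = weight n x"
  by (simp add: weight_def)

lemma frame_inner:
  assumes "k \<le> n"
  shows "q_pt n k \<bullet> q_pt n k = 1" "tau n k \<bullet> tau n k = 1" "q_pt n k \<bullet> tau n k = 0"
  using assms by (simp_all add: q_pt_def tau_def inner_vec_def sum_2 flip: power2_eq_square)

lemma norm_q_pt: "k \<le> n \<Longrightarrow> norm (q_pt n k) = 1"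
  by (simp add: norm_eq_1 frame_inner)

lemma frame_rotate:
  assumes "k \<le> n" "j \<le> n" "\<delta> = of_int (int j - int k) * theta n"
  shows "q_pt n j = cos \<delta> *\<^sub>R q_pt n k + sin \<delta> *\<^sub>R tau n k"
    and "tau n j = cos \<delta> *\<^sub>R tau n k - sin \<delta> *\<^sub>R q_pt n k"
proof -
  have j: "real j * theta n = real k * theta n + \<delta>"
    by (simp add: assms(3) algebra_simps)
  show "q_pt n j = cos \<delta> *\<^sub>R q_pt n k + sin \<delta> *\<^sub>R tau n k"
    "tau n j = cos \<delta> *\<^sub>R tau n k - sin \<delta> *\<^sub>R q_pt n k"
    unfolding q_pt_def tau_def j cos_add sin_add
    using assms(1,2) by (simp_all add: vec_eq_iff forall_2 algebra_simps)
qed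

lemma weight_eq:
  assumes "k \<le> n" "j \<le> n"
  shows "weight n (int j - int k) = 1 / (2 * norm (q_pt n k - q_pt n j) ^ 3)"
  using norm_rotated_frame[OF frame_inner[OF assms(1)] frame_rotate[OF assms refl]]
  by (simp add: weight_def)

text \<open>Including the index n closes the ring, so that index shifts apply; the added term has
  weight 0 by periodicity.\<close>

lemma sum_weight_eq:
  assumes "n > 0"
  shows "(\<Sum>k=1..n-1. h k / (2 * d_poly n n k ^ 3)) = (\<Sum>k=1..n. weight n (int k) * h k)"
proof -
  have "h k / (2 * d_poly n n k ^ 3) = weight n (int k) * h k" if "k \<le> n" for k
    using weight_eq[of n n k] weight_periodic[of n "int k - int n"] assms that by (simp add: d_poly_def)
  then have "(\<Sum>k=1..n-1. h k / (2 * d_poly n n k ^ 3)) = (\<Sum>k=1..n-1. weight n (int k) * h k)"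
    by (intro sum.cong refl) auto
  also have "\<dots> = (\<Sum>k=1..n. weight n (int k) * h k)"
  proof (rule sum.mono_neutral_left)
    have "{1..n} - {1..n-1} = {n}"
      using assms by auto
    then show "\<forall>k\<in>{1..n} - {1..n-1}. weight n (int k) * h k = 0"
      using weight_periodic[of n 0] assms by (simp add: weight_def)
  qed auto
  finally show ?thesis .
qed

lemma sum_odd_weight:
  assumes "n > 0" "\<And>x. G (x + int n) = G x" "\<And>x. G (- x) = - G x"
  shows "(\<Sum>j=1..n. weight n (int j) * G (int j)) = 0"
  using assms odd_periodic_sum_eq_0[of "\<lambda>x. weight n x * G x" n]
  by (simp add: weight_periodic weight_even)

text \<open>In the frame at vertex k the coefficients depend on j - k only, so a shift of the
  summation index removes k from both sums, and the tangential one is odd and cancels.\<close>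

lemma ring_force:
  assumes "k \<in> {1..n}"
  shows "(\<Sum>j=1..n. kern (q_pt n k - q_pt n j))
    = (\<Sum>j=1..n. weight n (int j) * (2 - 2 * cos (real j * theta n))) *\<^sub>R q_pt n k"
proof -
  have n: "n > 0" using assms by auto
  define P where "P = (\<lambda>x. weight n x * (2 - 2 * cos (of_int x * theta n)))"
  define Q where "Q = (\<lambda>x. weight n x * (- 2 * sin (of_int x * theta n)))"
  have per: "P (x + int n) = P x" "Q (x + int n) = Q x" for x
    using weight_periodic[OF n, of x] cos_theta_periodic[OF n, of 1 x] sin_theta_periodic[OF n, of 1 x]
    by (simp_all add: P_def Q_def)
  have "kern (q_pt n k - q_pt n j) = P (int j - int k) *\<^sub>R q_pt n k + Q (int j - int k) *\<^sub>R tau n k"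
    if "j \<in> {1..n}" for j
  proof -
    have kj: "k \<le> n" "j \<le> n" using assms that by auto
    have "kern (q_pt n k - q_pt n j) = (2 * weight n (int j - int k)) *\<^sub>R (q_pt n k - q_pt n j)"
      by (simp add: kern_def weight_eq[OF kj])
    then show ?thesis
      using frame_rotate(1)[OF kj refl] by (simp add: P_def Q_def algebra_simps)
  qed
  then have "(\<Sum>j=1..n. kern (q_pt n k - q_pt n j))
    = (\<Sum>j=1..n. P (int j - int k)) *\<^sub>R q_pt n k + (\<Sum>j=1..n. Q (int j - int k)) *\<^sub>R tau n k"
    by (simp add: sum.distrib scaleR_sum_left)
  also have "(\<Sum>j=1..n. P (int j - int k)) = (\<Sum>j=1..n. P (int j))"
    by (rule periodic_sum_shift) (rule per)
  also have "(\<Sum>j=1..n. Q (int j - int k)) = (\<Sum>j=1..n. Q (int j))"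
    by (rule periodic_sum_shift) (rule per)
  also have "\<dots> = 0"
    by (rule odd_periodic_sum_eq_0) (rule per, simp add: Q_def weight_even)
  finally show ?thesis by (simp add: P_def)
qed

section \<open>Ring sums of Fourier modes with a phase\<close>

context
  fixes n l :: nat and \<phi> :: real and c \<sigma> :: "nat \<Rightarrow> real" and C S Cl Sl :: "int \<Rightarrow> real"
  assumes n: "n > 0"
  defines "c \<equiv> \<lambda>k. cos (real l * real k * theta n + \<phi>)"
    and "\<sigma> \<equiv> \<lambda>k. sin (real l * real k * theta n + \<phi>)"
    and "C \<equiv> \<lambda>x. cos (of_int x * theta n)"
    and "S \<equiv> \<lambda>x. sin (of_int x * theta n)"
    and "Cl \<equiv> \<lambda>x. cos (real l * of_int x * theta n)"
    and "Sl \<equiv> \<lambda>x. sin (real l * of_int x * theta n)"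
begin

lemmas trig = C_def S_def Cl_def Sl_def

lemma trig_periodic: "weight n (x + int n) = weight n x" "C (x + int n) = C x"
    "S (x + int n) = S x" "Cl (x + int n) = Cl x" "Sl (x + int n) = Sl x"
  using weight_periodic[OF n, of x] cos_theta_periodic[OF n, of 1 x] sin_theta_periodic[OF n, of 1 x]
    cos_theta_periodic[OF n, of l x] sin_theta_periodic[OF n, of l x]
  by (simp_all add: trig)

lemma trig_parity: "C (- x) = C x" "S (- x) = - S x" "Cl (- x) = Cl x" "Sl (- x) = - Sl x"
  by (simp_all add: trig)

text \<open>Angle addition separates the dependence on j - k from that on k, which prepares the
  shift of the sum over j.\<close>

lemma c_shift: "c j = Cl (int j - int k) * c k - Sl (int j - int k) * \<sigma> k"
proof -
  have "real l * real j * theta n + \<phi> =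
      real l * of_int (int j - int k) * theta n + (real l * real k * theta n + \<phi>)"
    by (simp add: algebra_simps)
  then show ?thesis
    unfolding c_def \<sigma>_def trig by (simp only: cos_add)
qed

text \<open>After \<open>c_shift\<close> every coefficient is a function of j - k. The even part of
  the radial one yields \<open>U1\<close>, that of the tangential one yields the sine sum, and the
  odd parts cancel.\<close>

lemma ring_radial:
  assumes "k \<in> {1..n}"
  shows "(\<Sum>j=1..n. dkern (q_pt n k - q_pt n j) (c k *\<^sub>R q_pt n k - c j *\<^sub>R q_pt n j))
    = - ((U1 n l * c k) *\<^sub>R q_pt n k + (S_coeff n l * \<sigma> k) *\<^sub>R tau n k)"
proof -
  define b where "b = (\<lambda>x. Cl x * c k - Sl x * \<sigma> k)"
  define P where "P = (\<lambda>x. weight n x * (c k + 3 * b x - (3 * c k + b x) * C x))"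
  define Q where "Q = (\<lambda>x. weight n x * ((3 * c k + b x) * S x))"
  have "dkern (q_pt n k - q_pt n j) (c k *\<^sub>R q_pt n k - c j *\<^sub>R q_pt n j)
      = Q (int j - int k) *\<^sub>R tau n k - P (int j - int k) *\<^sub>R q_pt n k" if "j \<in> {1..n}" for j
  proof -
    have kj: "k \<le> n" "j \<le> n" using assms that by auto
    have "b (int j - int k) = c j"
      using c_shift[of j k] by (simp add: b_def)
    then show ?thesis
      unfolding dkern_radial[OF frame_inner[OF kj(1)] frame_rotate[OF kj refl]] weight_eq[OF kj, symmetric]
      by (simp add: P_def Q_def C_def S_def scaleR_diff_right)
  qed
  then have "(\<Sum>j=1..n. dkern (q_pt n k - q_pt n j) (c k *\<^sub>R q_pt n k - c j *\<^sub>R q_pt n j))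
    = (\<Sum>j=1..n. Q (int j - int k)) *\<^sub>R tau n k - (\<Sum>j=1..n. P (int j - int k)) *\<^sub>R q_pt n k"
    by (simp add: sum_subtractf scaleR_sum_left)
  also have "(\<Sum>j=1..n. P (int j - int k)) = (\<Sum>j=1..n. P (int j))"
    by (rule periodic_sum_shift) (simp add: P_def b_def trig_periodic)
  also have "(\<Sum>j=1..n. Q (int j - int k)) = (\<Sum>j=1..n. Q (int j))"
    by (rule periodic_sum_shift) (simp add: Q_def b_def trig_periodic)
  \<comment> \<open>The multiple of \<open>c k\<close> is even with the numerator of
    \<open>U1\<close>; the multiple of \<open>\<sigma> k\<close> carries the odd factor
    \<open>Sl\<close>.\<close>
  also have "(\<Sum>j=1..n. P (int j)) = U1 n l * c k - \<sigma> k * (\<Sum>j=1..n. weight n (int j) * (3 * Sl (int j) - Sl (int j) * C (int j)))"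
    unfolding U1_def sum_weight_eq[OF n] sum_distrib_left sum_distrib_right sum_subtractf[symmetric]
    by (intro sum.cong refl) (simp add: P_def b_def trig algebra_simps)
  also have "(\<Sum>j=1..n. weight n (int j) * (3 * Sl (int j) - Sl (int j) * C (int j))) = 0"
    by (rule sum_odd_weight[OF n]) (simp_all add: trig_periodic trig_parity)
  \<comment> \<open>The factor \<open>S\<close> reverses the parities: the multiple of
    \<open>c k\<close> is now odd and the product of two sines survives.\<close>
  also have "(\<Sum>j=1..n. Q (int j)) = c k * (\<Sum>j=1..n. weight n (int j) * (3 * S (int j) + Cl (int j) * S (int j))) - S_coeff n l * \<sigma> k"
    unfolding S_coeff_def sum_distrib_left sum_distrib_right sum_subtractf[symmetric]
    by (intro sum.cong refl) (simp add: Q_def b_def trig algebra_simps)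
  also have "(\<Sum>j=1..n. weight n (int j) * (3 * S (int j) + Cl (int j) * S (int j))) = 0"
    by (rule sum_odd_weight[OF n]) (simp_all add: trig_periodic trig_parity)
  finally show ?thesis by simp
qed

text \<open>The parity argument is that of \<open>ring_radial\<close>; the tangential formula for
  \<open>dkern\<close> changes the sign of 3 (cos k\<theta> - cos lk\<theta>), which replaces
  \<open>U1\<close> by \<open>U2'\<close>.\<close>

lemma ring_tangential:
  assumes "k \<in> {1..n}"
  shows "(\<Sum>j=1..n. dkern (q_pt n k - q_pt n j) (c k *\<^sub>R tau n k - c j *\<^sub>R tau n j))
    = - ((U2' n l * c k) *\<^sub>R tau n k - (S_coeff n l * \<sigma> k) *\<^sub>R q_pt n k)"
proof -
  define b where "b = (\<lambda>x. Cl x * c k - Sl x * \<sigma> k)"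
  define P where "P = (\<lambda>x. weight n x * (c k - 3 * b x + (3 * c k - b x) * C x))"
  define Q where "Q = (\<lambda>x. weight n x * ((3 * c k - b x) * S x))"
  have "dkern (q_pt n k - q_pt n j) (c k *\<^sub>R tau n k - c j *\<^sub>R tau n j)
      = Q (int j - int k) *\<^sub>R q_pt n k - P (int j - int k) *\<^sub>R tau n k" if "j \<in> {1..n}" for j
  proof -
    have kj: "k \<le> n" "j \<le> n" using assms that by auto
    have "b (int j - int k) = c j"
      using c_shift[of j k] by (simp add: b_def)
    then show ?thesis
      unfolding dkern_tangential[OF frame_inner[OF kj(1)] frame_rotate[OF kj refl]] weight_eq[OF kj, symmetric]
      by (simp add: P_def Q_def C_def S_def scaleR_diff_right)
  qed
  then have "(\<Sum>j=1..n. dkern (q_pt n k - q_pt n j) (c k *\<^sub>R tau n k - c j *\<^sub>R tau n j))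
    = (\<Sum>j=1..n. Q (int j - int k)) *\<^sub>R q_pt n k - (\<Sum>j=1..n. P (int j - int k)) *\<^sub>R tau n k"
    by (simp add: sum_subtractf scaleR_sum_left)
  also have "(\<Sum>j=1..n. P (int j - int k)) = (\<Sum>j=1..n. P (int j))"
    by (rule periodic_sum_shift) (simp add: P_def b_def trig_periodic)
  also have "(\<Sum>j=1..n. Q (int j - int k)) = (\<Sum>j=1..n. Q (int j))"
    by (rule periodic_sum_shift) (simp add: Q_def b_def trig_periodic)
  also have "(\<Sum>j=1..n. P (int j)) = U2' n l * c k + \<sigma> k * (\<Sum>j=1..n. weight n (int j) * (3 * Sl (int j) + Sl (int j) * C (int j)))"
    unfolding U2'_def sum_weight_eq[OF n] sum_distrib_left sum_distrib_right sum.distrib[symmetric]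
    by (intro sum.cong refl) (simp add: P_def b_def trig algebra_simps)
  also have "(\<Sum>j=1..n. weight n (int j) * (3 * Sl (int j) + Sl (int j) * C (int j))) = 0"
    by (rule sum_odd_weight[OF n]) (simp_all add: trig_periodic trig_parity)
  also have "(\<Sum>j=1..n. Q (int j)) = c k * (\<Sum>j=1..n. weight n (int j) * (3 * S (int j) - Cl (int j) * S (int j))) + S_coeff n l * \<sigma> k"
    unfolding S_coeff_def sum_distrib_left sum_distrib_right sum.distrib[symmetric]
    by (intro sum.cong refl) (simp add: Q_def b_def trig algebra_simps)
  also have "(\<Sum>j=1..n. weight n (int j) * (3 * S (int j) - Cl (int j) * S (int j))) = 0"
    by (rule sum_odd_weight[OF n]) (simp_all add: trig_periodic trig_parity)
  finally show ?thesis by simp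
qed

end

section \<open>The operator on radial and tangential Fourier modes\<close>

text \<open>A phase treats sines and cosines at once: \<open>v_vec\<close> and \<open>w_vec\<close>
  are the radial and tangential modes of phase 0, and \<open>v_vec'\<close> is the tangential mode
  of phase pi/2.\<close>

definition radial :: "('b::finite \<Rightarrow> nat) \<Rightarrow> nat \<Rightarrow> nat \<Rightarrow> real \<Rightarrow> (real^2)^'b" where
  "radial lab n l \<phi> = config lab (\<lambda>k. if k = n + 1 then 0
     else cos (real l * real k * theta n + \<phi>) *\<^sub>R q_pt n k)"

definition tangential :: "('b::finite \<Rightarrow> nat) \<Rightarrow> nat \<Rightarrow> nat \<Rightarrow> real \<Rightarrow> (real^2)^'b" where
  "tangential lab n l \<phi> = config lab (\<lambda>k. if k = n + 1 then 0
     else cos (real l * real k * theta n + \<phi>) *\<^sub>R tau n k)"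

text \<open>Product-to-sum leaves the frequencies l - 1 and l + 1, which the bounds on l keep
  strictly between 0 and n.\<close>

lemma cos_product_progression:
  assumes "2 \<le> l" "l + 1 < n"
  shows "(\<Sum>k=1..n. cos (real l * real k * theta n + \<phi>) * cos (real k * theta n + \<psi>)) = 0"
proof -
  have prod: "cos (real l * real k * theta n + \<phi>) * cos (real k * theta n + \<psi>) =
      (cos (real (l - 1) * real k * theta n + (\<phi> - \<psi>)) + cos (real (l + 1) * real k * theta n + (\<phi> + \<psi>))) / 2" for k
  proof -
    have "real l * real k * theta n + \<phi> - (real k * theta n + \<psi>) = real (l - 1) * real k * theta n + (\<phi> - \<psi>)"
      "real l * real k * theta n + \<phi> + (real k * theta n + \<psi>) = real (l + 1) * real k * theta n + (\<phi> + \<psi>)"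
      using assms by (simp_all add: of_nat_diff algebra_simps)
    then show ?thesis
      by (simp only: cos_times_cos)
  qed
  have "(\<Sum>k=1..n. cos (real (l - 1) * real k * theta n + (\<phi> - \<psi>))) = 0"
    "(\<Sum>k=1..n. cos (real (l + 1) * real k * theta n + (\<phi> + \<psi>))) = 0"
    using assms by (intro sum_cos_progression_eq_0; simp)+
  then show ?thesis
    unfolding prod sum_divide_distrib[symmetric] sum.distrib by simp
qed

text \<open>The coordinates of \<open>q_pt\<close> and \<open>tau\<close> are cosines of phase 0 or
  plus or minus pi/2. These sums appear as the component of the Hessian at the central mass.\<close>

lemma sum_radial_eq_0:
  assumes "2 \<le> l" "l + 1 < n"
  shows "(\<Sum>k=1..n. cos (real l * real k * theta n + \<phi>) *\<^sub>R q_pt n k) = 0"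
    and "(\<Sum>k=1..n. cos (real l * real k * theta n + \<phi>) *\<^sub>R tau n k) = 0"
proof -
  have cs: "cos (x - pi / 2) = sin x" "cos (x + pi / 2) = - sin x" for x :: real
    by (simp_all add: cos_diff cos_add)
  note * = cos_product_progression[OF assms, of \<phi> 0] cos_product_progression[OF assms, of \<phi> "- (pi / 2)"]
    cos_product_progression[OF assms, of \<phi> "pi / 2"]
  show "(\<Sum>k=1..n. cos (real l * real k * theta n + \<phi>) *\<^sub>R q_pt n k) = 0"
    "(\<Sum>k=1..n. cos (real l * real k * theta n + \<phi>) *\<^sub>R tau n k) = 0"
    using * by (simp_all add: vec_eq_iff forall_2 sum_component q_pt_def tau_def cs)
qed

section \<open>Labelled configurations and the centred polygon\<close>

context
  fixes lab :: "'b::finite \<Rightarrow> nat" and n :: nat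
  assumes lab: "bij_betw lab UNIV {1..n + 1}" and n: "n > 0"
begin

lemma sum_lab: "(\<Sum>i\<in>UNIV. h (lab i)) = (\<Sum>k=1..n. h k) + h (n + 1)"
  using sum.reindex_bij_betw[OF lab, of h] by simp

lemma lab_cases: "lab i = n + 1 \<or> lab i \<in> {1..n}"
  using bij_betw_apply[OF lab, of i] by auto

lemma config_eqI: "(\<And>k. k \<in> {1..n} \<Longrightarrow> x k = y k) \<Longrightarrow> x (n + 1) = y (n + 1) \<Longrightarrow> config lab x = config lab y"
  unfolding config_def by (rule arg_cong[of _ _ vec_lambda], rule ext) (metis lab_cases)

lemma inner_config: "config lab x \<bullet> config lab y = (\<Sum>k=1..n. x k \<bullet> y k) + x (n + 1) \<bullet> y (n + 1)"
  using sum_lab[of "\<lambda>k. x k \<bullet> y k"] by (simp add: config_def inner_vec_lambda)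

lemma mass_op_config: "mass_op lab n m (config lab x) = config lab (\<lambda>k. mass n m k *\<^sub>R x k)"
  by (simp add: mass_op_def config_def)

lemma grad_U_config:
  "grad_U lab n m (config lab x) = config lab (\<lambda>k. - ((\<Sum>j=1..n. mass n m k *\<^sub>R kern (x k - x j))
     + (mass n m k * m) *\<^sub>R kern (x k - x (n + 1))))"
proof -
  have "(\<Sum>j\<in>UNIV. (mass n m k * mass n m (lab j)) *\<^sub>R kern (x k - x (lab j)))
      = (\<Sum>j=1..n. mass n m k *\<^sub>R kern (x k - x j)) + (mass n m k * m) *\<^sub>R kern (x k - x (n + 1))" for k
    by (subst sum_lab) (simp add: mass_def)
  then show ?thesis
    by (simp add: grad_U_def config_def)
qed

lemma hess_U_config:
  "hess_U lab n m (config lab x) (config lab w) = config lab (\<lambda>k. - ((\<Sum>j=1..n. mass n m k *\<^sub>R dkern (x k - x j) (w k - w j))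
     + (mass n m k * m) *\<^sub>R dkern (x k - x (n + 1)) (w k - w (n + 1))))"
proof -
  have "(\<Sum>j\<in>UNIV. (mass n m k * mass n m (lab j)) *\<^sub>R dkern (x k - x (lab j)) (w k - w (lab j)))
      = (\<Sum>j=1..n. mass n m k *\<^sub>R dkern (x k - x j) (w k - w j)) + (mass n m k * m) *\<^sub>R dkern (x k - x (n + 1)) (w k - w (n + 1))" for k
    by (subst sum_lab) (simp add: mass_def)
  then show ?thesis
    by (simp add: hess_U_def config_def)
qed

text \<open>Half the angle between distinct vertices lies strictly between 0 and pi, so their chord
  is positive.\<close>

lemma q_pt_inj: 
  assumes "k \<in> {1..n}" "j \<in> {1..n}" "q_pt n k = q_pt n j"
  shows "k = j"
proof (rule ccontr)
  assume "k \<noteq> j"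
  define x where "x = \<bar>real k - real j\<bar> * theta n / 2"
  have "0 < \<bar>real k - real j\<bar>" "\<bar>real k - real j\<bar> < real n"
    using assms \<open>k \<noteq> j\<close> by (auto simp: abs_less_iff)
  then have "0 < x" "x < pi"
    using n by (simp_all add: x_def theta_def field_simps)
  then have "d_poly n k j > 0"
    using d_poly_eq[of k n j] assms by (simp add: x_def sin_gt_zero)
  then show False
    using assms by (simp add: d_poly_def)
qed

lemma z0_collision_free: "z0 lab n \<in> collision_free"
proof -
  have "i = j" if "q_pt n (lab i) = q_pt n (lab j)" for i j
  proof -
    have nz: "q_pt n k \<noteq> 0" if "k \<in> {1..n}" for k
      using norm_q_pt[of k n] that by auto
    have 0: "q_pt n (n + 1) = 0" by (simp add: q_pt_def)
    have "lab i = lab j"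
      using lab_cases[of i] lab_cases[of j] that nz 0 q_pt_inj by metis
    then show ?thesis
      using bij_betw_imp_inj_on[OF lab] by (simp add: inj_eq)
  qed
  then show ?thesis
    by (auto simp: collision_free_def z0_def config_def)
qed

text \<open>In terms of labels the pairs split into ring pairs and pairs with the centre, whose
  label n + 1 is the largest and so always comes second. The latter have distance 1.\<close>

lemma potential_z0: "potential lab n m (z0 lab n) = Ue0 n + real n * m"
proof -
  define h where "h = (\<lambda>(i, j). mass n m i * mass n m j / norm (q_pt n i - q_pt n j))"
  define L where "L = {(i, j). lab i < lab j}"
  define P where "P = {(k, j). 1 \<le> k \<and> k < j \<and> j \<le> n}"
  have "inj lab" using lab by (rule bij_betw_imp_inj_on)
  have "map_prod lab lab ` L = {(k, j). k \<in> {1..n+1} \<and> j \<in> {1..n+1} \<and> k < j}"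
  proof -
    have "range lab = {1..n+1}"
      using lab by (simp add: bij_betw_def)
    show ?thesis
      unfolding \<open>range lab = _\<close>[symmetric] by (auto simp: L_def)
  qed
  also have "\<dots> = P \<union> (\<lambda>k. (k, n + 1)) ` {1..n}"
    by (auto simp: P_def)
  finally have L: "map_prod lab lab ` L = P \<union> (\<lambda>k. (k, n + 1)) ` {1..n}" .
  have "finite P"
    by (rule finite_subset[of _ "{1..n} \<times> {1..n}"]) (auto simp: P_def)
  have "potential lab n m (z0 lab n) = sum (h \<circ> map_prod lab lab) L"
    by (simp add: potential_def z0_def config_def h_def L_def case_prod_unfold o_def)
  also have "\<dots> = sum h (map_prod lab lab ` L)"
    by (rule sum.reindex[symmetric]) (meson \<open>inj lab\<close> inj_on_subset prod.inj_map subset_UNIV)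
  also have "\<dots> = sum h P + sum h ((\<lambda>k. (k, n + 1)) ` {1..n})"
    unfolding L by (rule sum.union_disjoint) (use \<open>finite P\<close> in \<open>auto simp: P_def\<close>)
  also have "sum h P = Ue0 n"
    unfolding Ue0_def P_def[symmetric]
    by (rule sum.cong) (auto simp: P_def h_def mass_def d_poly_def)
  also have "sum h ((\<lambda>k. (k, n + 1)) ` {1..n}) = (\<Sum>k=1..n. m)"
  proof -
    have "q_pt n (n + 1) = 0" by (simp add: q_pt_def)
    then have "h (k, n + 1) = m" if "k \<in> {1..n}" for k
      using that by (simp add: h_def mass_def norm_q_pt)
    then show ?thesis
      by (simp add: sum.reindex inj_on_def)
  qed
  finally show ?thesis by simp
qed

text \<open>The polygon is a central configuration: on the ring the gradient is a fixed multiple of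
  position. Orthogonality to it thus follows from orthogonality to the gradient of the
  inertia.\<close>

lemma grad_U_z0:
  obtains \<mu> where "\<And>w. w (n + 1) = 0 \<Longrightarrow> grad_U lab n m (z0 lab n) \<bullet> config lab w = \<mu> * (\<Sum>k=1..n. q_pt n k \<bullet> w k)"
proof
  define \<kappa> where "\<kappa> = (\<Sum>j=1..n. weight n (int j) * (2 - 2 * cos (real j * theta n)))"
  fix w :: "nat \<Rightarrow> real^2" assume "w (n + 1) = 0"
  have "- ((\<Sum>j=1..n. mass n m k *\<^sub>R kern (q_pt n k - q_pt n j)) + (mass n m k * m) *\<^sub>R kern (q_pt n k - q_pt n (n + 1)))
      = - (\<kappa> + m) *\<^sub>R q_pt n k" if "k \<in> {1..n}" for k
  proof -
    have "kern (q_pt n k) = q_pt n k"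
      using that by (simp add: kern_def norm_q_pt)
    moreover have "q_pt n (n + 1) = 0" "mass n m k = 1"
      using that by (simp_all add: q_pt_def mass_def)
    ultimately show ?thesis
      using ring_force[OF that] by (simp add: \<kappa>_def algebra_simps)
  qed
  then show "grad_U lab n m (z0 lab n) \<bullet> config lab w = - (\<kappa> + m) * (\<Sum>k=1..n. q_pt n k \<bullet> w k)"
    using \<open>w (n + 1) = 0\<close>
    by (simp add: z0_def grad_U_config inner_config sum_distrib_left del: of_nat_Suc)
qed

lemma mass_op_z0:
  assumes "w (n + 1) = 0"
  shows "mass_op lab n m (z0 lab n) \<bullet> config lab w = (\<Sum>k=1..n. q_pt n k \<bullet> w k)"
  using assms by (simp add: z0_def mass_op_config inner_config mass_def)

text \<open>Both orthogonality conditions of \<open>hessian_f_fun\<close> reduce to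
  \<open>orth\<close>. The ring masses are 1 and \<open>w\<close> vanishes at the centre, so
  \<open>mass_op\<close> fixes the perturbation.\<close>

lemma H_op_config:
  assumes w: "w (n + 1) = 0" and orth: "(\<Sum>k=1..n. q_pt n k \<bullet> w k) = 0"
  shows "H_op lab n m (config lab w) =
    (Ue0 n / I0 n + I0 n * m) *\<^sub>R config lab w + I0 n *\<^sub>R hess_U lab n m (z0 lab n) (config lab w)"
proof -
  have I0: "I0 n > 0" using n by (simp add: I0_def)
  have sqrt: "sqrt (2 * inertia lab n m (z0 lab n)) = I0 n"
    by (rule I0_eq[OF lab, symmetric])
  have pos: "inertia lab n m (z0 lab n) > 0"
    using I0 unfolding sqrt[symmetric] by simp
  have mass_0: "mass_op lab n m (z0 lab n) \<bullet> config lab w = 0"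
    unfolding mass_op_z0[where w = w, OF w] orth ..
  obtain \<mu> where "grad_U lab n m (z0 lab n) \<bullet> config lab w = \<mu> * (\<Sum>k=1..n. q_pt n k \<bullet> w k)"
    using grad_U_z0 w by metis
  then have grad_0: "grad_U lab n m (z0 lab n) \<bullet> config lab w = 0"
    unfolding orth by simp
  have "mass_op lab n m (config lab w) = config lab w"
    unfolding mass_op_config using w by (intro config_eqI) (simp_all add: mass_def)
  moreover have "potential lab n m (z0 lab n) / I0 n = Ue0 n / I0 n + I0 n * m"
  proof -
    have "real n = I0 n * I0 n" by (simp add: I0_def)
    then show ?thesis
      using I0 by (simp add: potential_z0 add_divide_distrib)
  qed
  ultimately show ?thesis
    unfolding H_op_def
    using hessian_f_fun[OF bij_betw_imp_inj_on[OF lab] z0_collision_free pos mass_0 grad_0]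
    by (simp add: sqrt)
qed

text \<open>Vertices are at distance 1 from the centre, so these are the eigenvalues for the central
  pairs; the sign rules serve when the centre is the body acted upon.\<close>

lemma dkern_unit:
  assumes "norm q = 1"
  shows "dkern q (a *\<^sub>R q) = - (2 * a) *\<^sub>R q" and "q \<bullet> t = 0 \<Longrightarrow> dkern q (a *\<^sub>R t) = a *\<^sub>R t"
    and "dkern (- q) w = dkern q w" and "dkern q (- w) = - dkern q w"
proof -
  have "q \<bullet> q = 1" using assms by (simp add: norm_eq_1)
  then show "dkern q (a *\<^sub>R q) = - (2 * a) *\<^sub>R q" "q \<bullet> t = 0 \<Longrightarrow> dkern q (a *\<^sub>R t) = a *\<^sub>R t"
    "dkern (- q) w = dkern q w" "dkern q (- w) = - dkern q w"
    using assms by (simp_all add: dkern_def flip: scaleR_diff_left)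
qed

text \<open>A vertex feels the ring through \<open>ring_radial\<close> and the centre through the
  eigenvalue -2. Rewriting sine as a cosine of phase -pi/2 turns the coupling term into a tangential
  mode.\<close>

lemma hess_U_radial:
  assumes "2 \<le> l" "l + 1 < n"
  shows "hess_U lab n m (z0 lab n) (radial lab n l \<phi>) =
    (U1 n l + 2 * m) *\<^sub>R radial lab n l \<phi> + S_coeff n l *\<^sub>R tangential lab n l (\<phi> - pi / 2)"
proof -
  define c where "c = (\<lambda>k. cos (real l * real k * theta n + \<phi>))"
  define w where "w = (\<lambda>k. if k = n + 1 then 0 else c k *\<^sub>R q_pt n k)"
  have radial: "radial lab n l \<phi> = config lab w"
    by (simp add: radial_def w_def c_def cong: if_cong)
  have 0: "q_pt n (n + 1) = 0" "w (n + 1) = 0" by (simp_all add: q_pt_def w_def)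
  have wk: "w k = c k *\<^sub>R q_pt n k" if "k \<in> {1..n}" for k
    using that by (simp add: w_def)
  have norm: "norm (q_pt n k) = 1" if "k \<in> {1..n}" for k
    using norm_q_pt[of k n] that by simp
  have "hess_U lab n m (z0 lab n) (config lab w) = config lab (\<lambda>k. (U1 n l + 2 * m) *\<^sub>R w k
      + S_coeff n l *\<^sub>R (if k = n + 1 then 0 else cos (real l * real k * theta n + (\<phi> - pi / 2)) *\<^sub>R tau n k))"
    unfolding z0_def hess_U_config
  proof (rule config_eqI)
    fix k assume k: "k \<in> {1..n}"
    have "(\<Sum>j=1..n. dkern (q_pt n k - q_pt n j) (w k - w j))
        = (\<Sum>j=1..n. dkern (q_pt n k - q_pt n j) (c k *\<^sub>R q_pt n k - c j *\<^sub>R q_pt n j))"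
      by (intro sum.cong refl) (simp add: wk wk[OF k])
    also have "\<dots> = - ((U1 n l * c k) *\<^sub>R q_pt n k + (S_coeff n l * sin (real l * real k * theta n + \<phi>)) *\<^sub>R tau n k)"
      unfolding c_def by (rule ring_radial[OF n k])
    finally have ring: "(\<Sum>j=1..n. dkern (q_pt n k - q_pt n j) (w k - w j)) = \<dots>" .
    have mass: "mass n m k = 1" using k by (simp add: mass_def)
    have cos: "cos (real l * real k * theta n + (\<phi> - pi / 2)) = sin (real l * real k * theta n + \<phi>)"
      by (simp add: add_diff_eq cos_diff)
    have "k \<noteq> n + 1" using k by simp
    then show "- ((\<Sum>j=1..n. mass n m k *\<^sub>R dkern (q_pt n k - q_pt n j) (w k - w j))
        + (mass n m k * m) *\<^sub>R dkern (q_pt n k - q_pt n (n + 1)) (w k - w (n + 1))) =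
        (U1 n l + 2 * m) *\<^sub>R w k
      + S_coeff n l *\<^sub>R (if k = n + 1 then 0 else cos (real l * real k * theta n + (\<phi> - pi / 2)) *\<^sub>R tau n k)"
      using dkern_unit(1)[OF norm[OF k], of "c k"] 0
      by (simp only: mass scaleR_one mult_1 ring cos if_False) (simp add: wk[OF k] algebra_simps)
  next
    \<comment> \<open>The centre itself is not displaced, so its component collects only the
      displacements of the vertices.\<close>
    have "dkern (q_pt n (n + 1) - q_pt n j) (w (n + 1) - w j) = (2 * c j) *\<^sub>R q_pt n j" if "j \<in> {1..n}" for j
      using 0 that by (simp add: dkern_unit[OF norm] wk)
    then have "(\<Sum>j=1..n. dkern (q_pt n (n + 1) - q_pt n j) (w (n + 1) - w j)) = 2 *\<^sub>R (\<Sum>j=1..n. c j *\<^sub>R q_pt n j)"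
      by (simp add: scaleR_sum_right)
    also have "\<dots> = 0"
      using sum_radial_eq_0(1)[OF assms] by (simp add: c_def)
    finally show "- ((\<Sum>j=1..n. mass n m (n + 1) *\<^sub>R dkern (q_pt n (n + 1) - q_pt n j) (w (n + 1) - w j))
        + (mass n m (n + 1) * m) *\<^sub>R dkern (q_pt n (n + 1) - q_pt n (n + 1)) (w (n + 1) - w (n + 1))) =
        (U1 n l + 2 * m) *\<^sub>R w (n + 1)
      + S_coeff n l *\<^sub>R (if n + 1 = n + 1 then 0 else cos (real l * real (n + 1) * theta n + (\<phi> - pi / 2)) *\<^sub>R tau n (n + 1))"
      using 0 by (simp flip: scaleR_sum_right)
  qed
  then show ?thesis
    unfolding radial by (simp add: tangential_def config_def vec_eq_iff)
qed

text \<open>The decomposition is that of \<open>hess_U_radial\<close>, with the tangential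
  eigenvalue 1 for the centre.\<close>

lemma hess_U_tangential:
  assumes "2 \<le> l" "l + 1 < n"
  shows "hess_U lab n m (z0 lab n) (tangential lab n l \<phi>) =
    (U2' n l - m) *\<^sub>R tangential lab n l \<phi> - S_coeff n l *\<^sub>R radial lab n l (\<phi> - pi / 2)"
proof -
  define c where "c = (\<lambda>k. cos (real l * real k * theta n + \<phi>))"
  define w where "w = (\<lambda>k. if k = n + 1 then 0 else c k *\<^sub>R tau n k)"
  have tangential: "tangential lab n l \<phi> = config lab w"
    by (simp add: tangential_def w_def c_def cong: if_cong)
  have 0: "q_pt n (n + 1) = 0" "w (n + 1) = 0" by (simp_all add: q_pt_def w_def)
  have wk: "w k = c k *\<^sub>R tau n k" if "k \<in> {1..n}" for k
    using that by (simp add: w_def)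
  have norm: "norm (q_pt n k) = 1" "q_pt n k \<bullet> tau n k = 0" if "k \<in> {1..n}" for k
    using norm_q_pt[of k n] frame_inner[of k n] that by simp_all
  have "hess_U lab n m (z0 lab n) (config lab w) = config lab (\<lambda>k. (U2' n l - m) *\<^sub>R w k
      - S_coeff n l *\<^sub>R (if k = n + 1 then 0 else cos (real l * real k * theta n + (\<phi> - pi / 2)) *\<^sub>R q_pt n k))"
    unfolding z0_def hess_U_config
  proof (rule config_eqI)
    fix k assume k: "k \<in> {1..n}"
    have "(\<Sum>j=1..n. dkern (q_pt n k - q_pt n j) (w k - w j))
        = (\<Sum>j=1..n. dkern (q_pt n k - q_pt n j) (c k *\<^sub>R tau n k - c j *\<^sub>R tau n j))"
      by (intro sum.cong refl) (simp add: wk wk[OF k])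
    also have "\<dots> = - ((U2' n l * c k) *\<^sub>R tau n k - (S_coeff n l * sin (real l * real k * theta n + \<phi>)) *\<^sub>R q_pt n k)"
      unfolding c_def by (rule ring_tangential[OF n k])
    finally have ring: "(\<Sum>j=1..n. dkern (q_pt n k - q_pt n j) (w k - w j)) = \<dots>" .
    have mass: "mass n m k = 1" using k by (simp add: mass_def)
    have cos: "cos (real l * real k * theta n + (\<phi> - pi / 2)) = sin (real l * real k * theta n + \<phi>)"
      by (simp add: add_diff_eq cos_diff)
    have "k \<noteq> n + 1" using k by simp
    then show "- ((\<Sum>j=1..n. mass n m k *\<^sub>R dkern (q_pt n k - q_pt n j) (w k - w j))
        + (mass n m k * m) *\<^sub>R dkern (q_pt n k - q_pt n (n + 1)) (w k - w (n + 1))) =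
        (U2' n l - m) *\<^sub>R w k
      - S_coeff n l *\<^sub>R (if k = n + 1 then 0 else cos (real l * real k * theta n + (\<phi> - pi / 2)) *\<^sub>R q_pt n k)"
      using dkern_unit(2)[OF norm(1)[OF k] norm(2)[OF k], of "c k"] 0
      by (simp only: mass scaleR_one mult_1 ring cos if_False) (simp add: wk[OF k] algebra_simps)
  next
    have "dkern (q_pt n (n + 1) - q_pt n j) (w (n + 1) - w j) = - (c j *\<^sub>R tau n j)" if "j \<in> {1..n}" for j
      using 0 that by (simp add: dkern_unit(2-4)[OF norm(1)] norm wk)
    then have "(\<Sum>j=1..n. dkern (q_pt n (n + 1) - q_pt n j) (w (n + 1) - w j)) = - (\<Sum>j=1..n. c j *\<^sub>R tau n j)"
      by (simp add: sum_negf)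
    also have "\<dots> = 0"
      using sum_radial_eq_0(2)[OF assms] by (simp add: c_def)
    finally show "- ((\<Sum>j=1..n. mass n m (n + 1) *\<^sub>R dkern (q_pt n (n + 1) - q_pt n j) (w (n + 1) - w j))
        + (mass n m (n + 1) * m) *\<^sub>R dkern (q_pt n (n + 1) - q_pt n (n + 1)) (w (n + 1) - w (n + 1))) =
        (U2' n l - m) *\<^sub>R w (n + 1)
      - S_coeff n l *\<^sub>R (if n + 1 = n + 1 then 0 else cos (real l * real (n + 1) * theta n + (\<phi> - pi / 2)) *\<^sub>R q_pt n (n + 1))"
      using 0 by (simp flip: scaleR_sum_right)
  qed
  then show ?thesis
    unfolding tangential by (simp add: radial_def config_def vec_eq_iff)
qed

text \<open>The mode is orthogonal to the gradients because its inner products with the positions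
  form a vanishing cosine sum. The term 2 m from the centre joins the m from the prefactor to give 3
  m.\<close>

lemma H_op_radial:
  assumes "2 \<le> l" "l + 1 < n"
  shows "H_op lab n m (radial lab n l \<phi>) =
    (Ue0 n / I0 n + I0 n * U1 n l + 3 * I0 n * m) *\<^sub>R radial lab n l \<phi>
    + (I0 n * S_coeff n l) *\<^sub>R tangential lab n l (\<phi> - pi / 2)"
proof -
  have "(\<Sum>k=1..n. q_pt n k \<bullet> (if k = n + 1 then 0 else cos (real l * real k * theta n + \<phi>) *\<^sub>R q_pt n k))
      = (\<Sum>k=1..n. cos (real l * real k * theta n + \<phi>))"
    by (intro sum.cong refl) (simp add: frame_inner)
  also have "\<dots> = 0"
    using assms by (intro sum_cos_progression_eq_0) auto
  finally have "H_op lab n m (radial lab n l \<phi>) = (Ue0 n / I0 n + I0 n * m) *\<^sub>R radial lab n l \<phi>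
      + I0 n *\<^sub>R hess_U lab n m (z0 lab n) (radial lab n l \<phi>)"
    unfolding radial_def by (intro H_op_config) simp_all
  then show ?thesis
    by (simp add: hess_U_radial[OF assms] algebra_simps flip: scaleR_add_left)
qed

text \<open>Orthogonality holds vertex by vertex, and the -m from the centre cancels the m from the
  prefactor, so the eigenvalue part is free of m.\<close>

lemma H_op_tangential:
  assumes "2 \<le> l" "l + 1 < n"
  shows "H_op lab n m (tangential lab n l \<phi>) =
    (Ue0 n / I0 n + I0 n * U2' n l) *\<^sub>R tangential lab n l \<phi>
    - (I0 n * S_coeff n l) *\<^sub>R radial lab n l (\<phi> - pi / 2)"
proof -
  have "(\<Sum>k=1..n. q_pt n k \<bullet> (if k = n + 1 then 0 else cos (real l * real k * theta n + \<phi>) *\<^sub>R tau n k)) = 0"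
    by (intro sum.neutral ballI) (simp add: frame_inner)
  then have "H_op lab n m (tangential lab n l \<phi>) = (Ue0 n / I0 n + I0 n * m) *\<^sub>R tangential lab n l \<phi>
      + I0 n *\<^sub>R hess_U lab n m (z0 lab n) (tangential lab n l \<phi>)"
    unfolding tangential_def by (intro H_op_config) simp_all
  then show ?thesis
    by (simp add: hess_U_tangential[OF assms] algebra_simps)
qed

section \<open>Independence of the modes and the determinant\<close>

lemma config_radial_tangential_eq_0:
  assumes "config lab (\<lambda>k. if k = n + 1 then 0 else a k *\<^sub>R q_pt n k + b k *\<^sub>R tau n k) = 0" "k \<in> {1..n}"
  shows "a k = 0" "b k = 0"
proof -
  have "k \<in> range lab"
    using bij_betw_imp_surj_on[OF lab] assms(2) by simp
  then obtain i where i: "lab i = k"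
    by auto
  have "a k *\<^sub>R q_pt n k + b k *\<^sub>R tau n k = 0"
    using arg_cong[OF assms(1), of "\<lambda>v. v $ i"] assms(2) by (simp add: config_def i)
  then have "(a k *\<^sub>R q_pt n k + b k *\<^sub>R tau n k) \<bullet> q_pt n k = 0" "(a k *\<^sub>R q_pt n k + b k *\<^sub>R tau n k) \<bullet> tau n k = 0"
    by simp_all
  then show "a k = 0" "b k = 0"
    using assms(2) by (simp_all add: inner_add_left frame_inner inner_commute[of "tau n k" "q_pt n k"])
qed

lemma det_A_mat:
  assumes "n \<ge> 4" "2 \<le> l" "l \<le> n div 2"
  shows "det (A_mat lab n l m) = 
    (Ue0 n / I0 n + I0 n * U1 n l + 3 * I0 n * m) * (Ue0 n / I0 n + I0 n * U2' n l) - (I0 n * S_coeff n l)\<^sup>2"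
proof -
  have l: "2 \<le> l" "l + 1 < n" "l > 0" using assms by linarith+
  define \<alpha> where "\<alpha> = Ue0 n / I0 n + I0 n * U1 n l + 3 * I0 n * m"
  define \<beta> where "\<beta> = Ue0 n / I0 n + I0 n * U2' n l"
  define s where "s = I0 n * S_coeff n l"
  have sh: "cos (x - pi / 2) = sin x" "cos (x + pi / 2) = - sin x" for x :: real
    by (simp_all add: cos_diff cos_add)
  have v: "v_vec lab n l = radial lab n l 0" and w: "w_vec lab n l = tangential lab n l 0"
    by (simp_all add: v_vec_def w_vec_def radial_def tangential_def cong: if_cong)
  \<comment> \<open>Phases pi/2 and -pi/2 differ by half a turn, hence the sign. The first form
    feeds \<open>v_vec'\<close> into \<open>H_op\<close>; the second recognises it in the image of
    \<open>v_vec\<close>.\<close>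
  have v': "v_vec' lab n l = tangential lab n l (pi / 2)" "v_vec' lab n l = - tangential lab n l (- (pi / 2))"
    by (auto simp: v_vec'_def tangential_def sh config_def vec_eq_iff)
  have Hv: "H_op lab n m (v_vec lab n l) = \<alpha> *\<^sub>R v_vec lab n l + (- s) *\<^sub>R v_vec' lab n l"
    using H_op_radial[OF l(1,2), of m 0] by (simp add: v v'(2) \<alpha>_def s_def)
  have Hv': "H_op lab n m (v_vec' lab n l) = (- s) *\<^sub>R v_vec lab n l + \<beta> *\<^sub>R v_vec' lab n l"
    using H_op_tangential[OF l(1,2), of m "pi / 2"] by (simp add: v v'(1) \<beta>_def s_def)
  have nn: "n \<in> {1..n}" "1 \<in> {1..n}" using n by auto
  have n\<theta>: "real l * real n * theta n = 2 * real l * pi"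
    using n by (simp add: theta_def)
  show ?thesis
  proof (cases "2 * l < n")
    case True
    \<comment> \<open>Independence makes the matrix selected by \<open>THE\<close> unique. Vertex n,
      with cosine 1, isolates a; vertex 1 isolates b, since 2 l < n puts l \<theta> strictly between
      0 and pi.\<close>
    have indep: "a = 0 \<and> b = 0" if "a *\<^sub>R v_vec lab n l + b *\<^sub>R v_vec' lab n l = 0" for a b
    proof -
      have *: "config lab (\<lambda>k. if k = n + 1 then 0 else (a * cos (real l * real k * theta n)) *\<^sub>R q_pt n k
           + (- b * sin (real l * real k * theta n)) *\<^sub>R tau n k) = 0"
        unfolding that[symmetric] v_vec_def v_vec'_def by (simp add: config_def vec_eq_iff)
      have "a * cos (real l * real n * theta n) = 0"
        using config_radial_tangential_eq_0(1)[OF * nn(1)] .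
      then have "a = 0" unfolding n\<theta> cos_2npi by simp
      have "0 < real l * theta n" "real l * theta n < pi"
        using True l n by (simp_all add: theta_def field_simps)
      then have "sin (real l * theta n) > 0" by (rule sin_gt_zero)
      then have "b = 0"
        using config_radial_tangential_eq_0(2)[OF * nn(2)] by simp
      with \<open>a = 0\<close> show ?thesis by simp
    qed
    define M :: "real^2^2" where "M = vector [vector [\<alpha>, - s], vector [- s, \<beta>]]"
    have "(THE M. is_restriction_matrix (H_op lab n m) (v_vec lab n l) (v_vec' lab n l) M) = M"
    proof (rule the_equality)
      show "is_restriction_matrix (H_op lab n m) (v_vec lab n l) (v_vec' lab n l) M"
        by (simp add: is_restriction_matrix_def M_def Hv Hv')
    next
      fix N assume "is_restriction_matrix (H_op lab n m) (v_vec lab n l) (v_vec' lab n l) N"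
      then have "(N $ 1 $ 1 - \<alpha>) *\<^sub>R v_vec lab n l + (N $ 2 $ 1 - - s) *\<^sub>R v_vec' lab n l = 0"
        "(N $ 1 $ 2 - - s) *\<^sub>R v_vec lab n l + (N $ 2 $ 2 - \<beta>) *\<^sub>R v_vec' lab n l = 0"
        unfolding is_restriction_matrix_def Hv Hv' by (simp_all add: algebra_simps)
      from indep[OF this(1)] indep[OF this(2)] show "N = M"
        by (simp add: vec_eq_iff forall_2 M_def)
    qed
    then have "A_mat lab n l m = M"
      using True by (simp add: A_mat_def)
    then show ?thesis
      by (simp add: det_2 M_def \<alpha>_def \<beta>_def s_def power2_eq_square)
  next
    case False
    then have n2: "n = 2 * l" using assms by linarith
    \<comment> \<open>For n = 2 l the angle l k \<theta> is k pi, so the coupling vanishes and the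
      diagonal matrix obeys the same determinant formula.\<close>
    have "sin (real l * real k * theta n) = 0" for k
    proof -
      have "real l * real k * theta n = pi * real k"
        using l by (simp add: theta_def n2)
      then show ?thesis by (simp only: sin_npi2)
    qed
    then have "S_coeff n l = 0"
      by (simp add: S_coeff_def)
    then have s: "s = 0" by (simp add: s_def)
    have Hw: "H_op lab n m (w_vec lab n l) = \<beta> *\<^sub>R w_vec lab n l"
      using H_op_tangential[OF l(1,2), of m 0] \<open>S_coeff n l = 0\<close> by (simp add: w \<beta>_def)
    \<comment> \<open>Nonzero eigenvectors determine their eigenvalues; the cosine 1 at vertex n
      shows that neither vector vanishes.\<close>
    have nz: "v_vec lab n l \<noteq> 0" "w_vec lab n l \<noteq> 0"
    proof -
      have "cos (real l * real n * theta n) \<noteq> 0"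
        unfolding n\<theta> cos_2npi by simp
      then show "v_vec lab n l \<noteq> 0" "w_vec lab n l \<noteq> 0"
        using config_radial_tangential_eq_0(1)[OF _ nn(1), of "\<lambda>k. cos (real l * real k * theta n)" "\<lambda>k. 0"]
          config_radial_tangential_eq_0(2)[OF _ nn(1), of "\<lambda>k. 0" "\<lambda>k. cos (real l * real k * theta n)"]
        by (auto simp: v_vec_def w_vec_def cong: if_cong)
    qed
    define M :: "real^2^2" where "M = vector [vector [\<alpha>, 0], vector [0, \<beta>]]"
    have "(THE M. is_eigenvalue_matrix (H_op lab n m) (v_vec lab n l) (w_vec lab n l) M) = M"
    proof (rule the_equality)
      show "is_eigenvalue_matrix (H_op lab n m) (v_vec lab n l) (w_vec lab n l) M"
        by (simp add: is_eigenvalue_matrix_def M_def Hv Hw s)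
    next
      fix N assume "is_eigenvalue_matrix (H_op lab n m) (v_vec lab n l) (w_vec lab n l) N"
      then have "N $ 1 $ 1 = \<alpha>" "N $ 2 $ 2 = \<beta>" "N $ 1 $ 2 = 0" "N $ 2 $ 1 = 0"
        using nz by (simp_all add: is_eigenvalue_matrix_def Hv Hw s)
      then show "N = M"
        by (simp add: vec_eq_iff forall_2 M_def)
    qed
    then have "A_mat lab n l m = M"
      using False by (simp add: A_mat_def)
    then show ?thesis
      using \<open>S_coeff n l = 0\<close> by (simp add: det_2 M_def \<alpha>_def \<beta>_def)
  qed
qed

end

text \<open>The factors i and -i multiply to 1, so the subtracted complex product is the square of
  the real coupling.\<close>

lemma a_coeff_eq:
  assumes "n > 0"
  shows "a_coeff n l = (Ue0 n / I0 n + I0 n * U1 n l) * (Ue0 n / I0 n + I0 n * U2' n l) - (I0 n * S_coeff n l)\<^sup>2"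
proof -
  have S: "S_coeff n l = (\<Sum>k=1..n-1. sin (real k * theta n) * sin (real l * real k * theta n) / (2 * d_poly n n k ^ 3))"
    unfolding sum_weight_eq[OF assms] S_coeff_def ..
  have "U2 n l = \<i> * of_real (S_coeff n l)" "U1' n l = - \<i> * of_real (S_coeff n l)"
    unfolding U2_def U1'_def S of_real_sum sum_distrib_left by (simp_all add: mult.assoc)
  then show ?thesis
    by (simp add: a_coeff_def power2_eq_square)
qed

theorem theorem3:
  fixes lab :: "'b::finite \<Rightarrow> nat" and n l :: nat
  assumes "n \<ge> 4"
    and "bij_betw lab UNIV {1..n + 1}"
    and "2 \<le> l" and "l \<le> n div 2"
    and "a_coeff n l * (Ue0 n / I0 n + I0 n * U2' n l) < 0"
  shows "(\<exists>!m. 0 < m \<and> det (A_mat lab n l m) = 0) \<and>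
         (THE m. 0 < m \<and> det (A_mat lab n l m) = 0)
           = - a_coeff n l / (3 * I0 n * (Ue0 n / I0 n + I0 n * U2' n l))"
proof -
  define \<beta> where "\<beta> = Ue0 n / I0 n + I0 n * U2' n l"
  have n: "n > 0" using assms(1) by simp
  have det: "det (A_mat lab n l m) = a_coeff n l + 3 * I0 n * \<beta> * m" for m
    unfolding det_A_mat[OF assms(2) n assms(1,3,4)] a_coeff_eq[OF n] \<beta>_def[symmetric]
    by (simp add: algebra_simps)
  have I0: "I0 n > 0" using n by (simp add: I0_def)
  have neg: "a_coeff n l * \<beta> < 0" using assms(5) by (simp add: \<beta>_def)
  define m0 where "m0 = - a_coeff n l / (3 * I0 n * \<beta>)"
  \<comment> \<open>The hypothesis says that \<open>a_coeff n l\<close> and \<beta> have opposite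
    signs.\<close>
  have "m0 > 0"
    using neg I0 by (auto simp: m0_def mult_less_0_iff zero_less_divide_iff zero_less_mult_iff divide_less_0_iff)
  have "det (A_mat lab n l m) = 0 \<longleftrightarrow> m = m0" for m
  proof -
    \<comment> \<open>Strict negativity of the product excludes \<beta> = 0, so the affine
      determinant has exactly one zero.\<close>
    have "3 * I0 n * \<beta> \<noteq> 0" using neg I0 by auto
    then have "m = m0 \<longleftrightarrow> m * (3 * I0 n * \<beta>) = - a_coeff n l"
      unfolding m0_def by (simp only: eq_divide_eq simp_thms if_True)
    then show ?thesis
      unfolding det by (simp only: mult.commute[of m]) linarith
  qed
  then have "0 < m \<and> det (A_mat lab n l m) = 0 \<longleftrightarrow> m = m0" for m
    using \<open>m0 > 0\<close> by auto
  then show ?thesis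
    by (simp add: m0_def \<beta>_def)
qed

end
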